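(* For every chordless graph $G$ with maximum degree $\Delta$, the strong chromatic index satisfies $\chi'_s(G)\leq 3\Delta$.
   Context: All graphs are finite, simple and undirected. A graph is chordless if no cycle of the graph has a chord (an edge joining two non-consecutive vertices of the cycle). An induced matching is a set of pairwise vertex-disjoint edges such that no two endpoints belonging to different edges of the set are adjacent. A strong edge colouring of $G$ is an assignment of colours to the edges of $G$ such that each colour class is an induced matching; $\chi'_s(G)$ is the minimum number of colours in a strong edge colouring of $G$. *)

theory Defs
  imports Main
begin

text \<open>A graph is given by its vertex set \<open>V\<close> and its set \<open>E\<close> of two-element edges.\<close>

definition simple_graph :: "'a set \<Rightarrow> 'a set set \<Rightarrow> bool" where
  "simple_graph V E \<longleftrightarrow> finite V \<and> (\<forall>e\<in>E. e \<subseteq> V \<and> card e = 2)"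

definition vertex_degree :: "'a set set \<Rightarrow> 'a \<Rightarrow> nat" where
  "vertex_degree E v = card {e \<in> E. v \<in> e}"

text \<open>Inserting 0 only matters for the graph without vertices, whose maximum degree is
  taken to be 0.\<close>

definition max_degree :: "'a set \<Rightarrow> 'a set set \<Rightarrow> nat" where
  "max_degree V E = Max (insert 0 (vertex_degree E ` V))"

text \<open>A cycle is listed by its distinct vertices in cyclic order; the first vertex is not
  repeated at the end.\<close>

definition is_cycle :: "'a set set \<Rightarrow> 'a list \<Rightarrow> bool" where
  "is_cycle E vs \<longleftrightarrow> length vs \<ge> 3 \<and> distinct vs \<and>
     (\<forall>i<length vs. {vs ! i, vs ! (Suc i mod length vs)} \<in> E)"

definition is_chord :: "'a set set \<Rightarrow> 'a list \<Rightarrow> 'a set \<Rightarrow> bool" where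
  "is_chord E vs e \<longleftrightarrow> e \<in> E \<and>
     (\<exists>i<length vs. \<exists>j<length vs. e = {vs ! i, vs ! j} \<and> i \<noteq> j \<and>
        j \<noteq> Suc i mod length vs \<and> i \<noteq> Suc j mod length vs)"

definition chordless :: "'a set set \<Rightarrow> bool" where
  "chordless E \<longleftrightarrow> (\<forall>vs. is_cycle E vs \<longrightarrow> \<not> (\<exists>e. is_chord E vs e))"

definition induced_matching :: "'a set set \<Rightarrow> 'a set set \<Rightarrow> bool" where
  "induced_matching E M \<longleftrightarrow> M \<subseteq> E \<and>
     (\<forall>e\<in>M. \<forall>f\<in>M. e \<noteq> f \<longrightarrow> e \<inter> f = {} \<and> (\<forall>u\<in>e. \<forall>v\<in>f. {u, v} \<notin> E))"

definition strong_edge_colouring :: "'a set set \<Rightarrow> ('a set \<Rightarrow> 'c) \<Rightarrow> bool" where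
  "strong_edge_colouring E c \<longleftrightarrow> (\<forall>k. induced_matching E {e \<in> E. c e = k})"

text \<open>The values of a colouring outside \<open>E\<close> are irrelevant, and natural numbers suffice as
  colours because \<open>E\<close> is finite. The lemmas below show that the minimum is attained, so
  that \<open>LEAST\<close> is meaningful here.\<close>

definition strong_chromatic_index :: "'a set set \<Rightarrow> nat" where
  "strong_chromatic_index E =
     (LEAST k. \<exists>c :: 'a set \<Rightarrow> nat. strong_edge_colouring E c \<and> card (c ` E) = k)"

lemma simple_graph_finite_edges:
  assumes "simple_graph V E"
  shows "finite E"
  using assms by (auto simp: simple_graph_def intro: finite_subset[of E "Pow V"])

lemma strong_edge_colouring_exists:
  fixes E :: "'a set set"
  assumes "finite E"
  shows "\<exists>c :: 'a set \<Rightarrow> nat. strong_edge_colouring E c"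
proof -
  from finite_imp_inj_to_nat_seg[OF assms] obtain c :: "'a set \<Rightarrow> nat" where "inj_on c E"
    by auto
  then have c: "strong_edge_colouring E c"
    by (auto simp: strong_edge_colouring_def induced_matching_def dest: inj_onD)
  show ?thesis by (rule exI[of _ c]) (rule c)
qed

lemma strong_chromatic_index_attained:
  fixes E :: "'a set set"
  assumes "finite E"
  shows "\<exists>c :: 'a set \<Rightarrow> nat. strong_edge_colouring E c \<and> card (c ` E) = strong_chromatic_index E"
  unfolding strong_chromatic_index_def
  by (rule LeastI_ex) (use strong_edge_colouring_exists[OF assms] in auto)

lemma strong_chromatic_index_le:
  fixes E :: "'a set set" and c :: "'a set \<Rightarrow> nat"
  assumes "strong_edge_colouring E c"
  shows "strong_chromatic_index E \<le> card (c ` E)"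
  unfolding strong_chromatic_index_def by (rule Least_le) (use assms in auto)

end

theory Submission
  imports Defs
begin

text \<open>Deleting an edge of a chordless graph leaves its ends separated by at most one vertex. This
  property drives both halves of the proof. First, contracting a matching always leaves a
  3-colourable graph: if two vertices of degree at least 3 are adjacent, the graph is split at that
  edge and the two parts are coloured separately, and otherwise the contraction has a vertex of
  degree at most 2. Second, for \<open>\<Delta> \<ge> 3\<close> the edges fall into \<open>\<Delta>\<close> matchings: in a part without
  cut vertices some vertex of degree at least 3 has at most one neighbour of degree at least 3, and
  merging two of its neighbours of degree 2 gives a smaller graph whose colouring extends. The ends
  of an edge of a matching share a colour of the contraction, so this colour refines the matching
  into three induced matchings. For \<open>\<Delta> \<le> 2\<close> a greedy colouring suffices.\<close>

section \<open>Separating the ends of an edge\<close>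

text \<open>Both inductions also add edges: a shortcut in place of a deleted side, or an edge at a
  merged vertex. Chordlessness would then have to be rechecked on all new cycles; for
  \<open>edge_separable\<close> it suffices to exhibit two sides for each edge. Splitting at an edge
  between \<open>u\<close> and \<open>x\<close> leaves an obstacle: the parts may share a vertex
  \<open>y\<close>, and the colours must fit at \<open>y\<close> and across the edge at once. A
  permutation of the colours achieves this only if the right vertices are distinguished, so a short
  path stands in for a deleted side and forces it. In the edge colouring, the edges from a vertex
  \<open>u\<close> to its neighbours of degree 2 are restored last. Each has one forbidden colour
  besides those present at \<open>u\<close>; the only dead end is that all these forbidden colours
  agree, and merging two of the neighbours excludes it. The case distinction on \<Delta> is forced:
  an odd cycle is not a union of two matchings, while the greedy bound 2 * \<Delta> * (\<Delta> - 1)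
  is below 3 * \<Delta> only for positive \<Delta> at most 2.\<close>

definition separated :: "'a set set \<Rightarrow> 'a \<Rightarrow> 'a \<Rightarrow> 'a set \<Rightarrow> 'a set \<Rightarrow> bool" where
  "separated E u x U W \<longleftrightarrow> u \<in> U - W \<and> x \<in> W - U \<and>
     (\<forall>e\<in>E. e = {u, x} \<or> e \<subseteq> U \<or> e \<subseteq> W) \<and> (\<forall>p\<in>U \<inter> W. \<forall>q\<in>U \<inter> W. p = q)"

definition edge_separable :: "'a set set \<Rightarrow> bool" where
  "edge_separable E \<longleftrightarrow> (\<forall>u x. {u, x} \<in> E \<longrightarrow> u \<noteq> x \<longrightarrow> (\<exists>U W. separated E u x U W))"

section \<open>Two internally disjoint paths\<close>

definition path_between :: "'a set set \<Rightarrow> 'a \<Rightarrow> 'a \<Rightarrow> 'a list \<Rightarrow> bool" where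
  "path_between E u x ps \<longleftrightarrow> ps \<noteq> [] \<and> hd ps = u \<and> last ps = x \<and> distinct ps \<and>
     successively (\<lambda>a b. {a, b} \<in> E) ps"

text \<open>A walk becomes a path by cutting it back to the earlier occurrence whenever it returns
  to a visited vertex.\<close>

lemma rtrancl_path_between:
  assumes "(u, x) \<in> {(a, b). {a, b} \<in> E \<and> b \<notin> Y}\<^sup>*" "u \<notin> Y"
  shows "\<exists>ps. path_between E u x ps \<and> set ps \<inter> Y = {}"
  using assms(1)
proof (induction rule: rtrancl_induct)
  case base
  show ?case by (rule exI[of _ "[u]"]) (use assms(2) in \<open>auto simp: path_between_def\<close>)
next
  case (step a b)
  then obtain ps where ps: "path_between E u a ps" "set ps \<inter> Y = {}" by blast
  show ?case
  proof (cases "b \<in> set ps")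
    case True
    then obtain ys zs where "ps = ys @ b # zs" by (meson split_list)
    with ps have "path_between E u b (ys @ [b]) \<and> set (ys @ [b]) \<inter> Y = {}"
      by (cases ys) (auto simp: path_between_def successively_append_iff successively_Cons hd_append)
    then show ?thesis by blast
  next
    case False
    with ps step(2) have "path_between E u b (ps @ [b]) \<and> set (ps @ [b]) \<inter> Y = {}"
      by (auto simp: path_between_def successively_append_iff)
    then show ?thesis by blast
  qed
qed

text \<open>Whitney's argument: a pair of paths from \<open>u\<close> to a vertex \<open>p\<close> of a fixed path is pushed
  along that path, using a detour around \<open>p\<close>, until it reaches the end.\<close>

lemma two_disjoint_paths_aux:
  assumes "\<And>y. y \<noteq> u \<Longrightarrow> y \<noteq> x \<Longrightarrow> \<exists>ps. path_between E u x ps \<and> y \<notin> set ps"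
    and "path_between E p x (p # T)" "u \<notin> set (p # T)"
    and "path_between E u p A" "path_between E u p B"
    and "set A \<inter> set B = {u, p}" "(set A \<union> set B) \<inter> set T = {}"
  shows "\<exists>A B. path_between E u x A \<and> path_between E u x B \<and> set A \<inter> set B = {u, x}"
  using assms(2-)
proof (induction "length T" arbitrary: p T A B rule: less_induct)
  case less
  show ?case
  proof (cases "T = []")
    case True
    with less.prems(1) have "p = x" by (simp add: path_between_def)
    with less.prems show ?thesis by blast
  next
    case False
    have x: "x \<in> set T" and px: "p \<noteq> x" "p \<noteq> u"
      using less.prems(1,2) False last_in_set[of T] by (auto simp: path_between_def)
    then obtain R where R: "path_between E u x R" "p \<notin> set R" using assms(1)[of p] by blast
    have uA: "u \<in> set A" "u \<in> set B" using less.prems(5) by auto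
    have "\<exists>r\<in>set R. r \<in> set A \<union> set B"
      using R(1) uA hd_in_set[of R] by (auto simp: path_between_def)
    \<comment> \<open>\<open>r\<close> is the last vertex of the detour on the two paths, and
      \<open>s\<close> is the first vertex of the tail \<open>T\<close> after it. Leaving one path
      at \<open>r\<close> along the detour, and continuing the other from \<open>p\<close> along the
      tail, gives two paths to \<open>s\<close> that meet only in \<open>u\<close> and
      \<open>s\<close>.\<close>
    then obtain R1 r R2 where R12: "R = R1 @ r # R2" "r \<in> set A \<union> set B"
      "\<forall>t\<in>set R2. t \<notin> set A \<union> set B"
      using split_list_last_prop[of R "\<lambda>r. r \<in> set A \<union> set B"] by auto
    have "r \<noteq> x" using R12(2) less.prems(6) x by auto
    then have "x \<in> set R2"
      using R(1) R12(1) last_in_set[of R2] by (auto simp: path_between_def split: if_splits)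
    then obtain S s S' where S: "R2 = S @ s # S'" "s \<in> set T" "\<forall>t\<in>set S. t \<notin> set T"
      using split_list_first_prop[of R2 "\<lambda>t. t \<in> set T"] x by auto
    obtain T0 T' where T: "T = T0 @ s # T'" using S(2) by (meson split_list)
    \<comment> \<open>Stated for arbitrary \<open>A\<close> and \<open>B\<close>, so that exchanging
      the two paths covers the case of \<open>r\<close> on the second one.\<close>
    have step: ?thesis if r: "r \<in> set A" and A: "path_between E u p A" and B: "path_between E u p B"
      and AB: "set A \<inter> set B = {u, p}" "(set A \<union> set B) \<inter> set T = {}"
      and R2: "\<forall>t\<in>set R2. t \<notin> set A \<union> set B" for A B
    proof -
      obtain A1 A2 where A12: "A = A1 @ r # A2" using r by (meson split_list)
      have rp: "r \<noteq> p" using R(2) R12(1) by auto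
      have "last (r # A2) = p" using A A12 by (simp add: path_between_def)
      with rp have "p \<in> set A2" using last_in_set[of A2] by (auto split: if_splits)
      with A A12 have p: "p \<notin> set (A1 @ [r])" by (auto simp: path_between_def)
      have u: "u \<in> set (A1 @ [r])" using A A12 by (cases A1) (auto simp: path_between_def)
      have sR: "successively (\<lambda>a b. {a, b} \<in> E) (r # S @ [s])" "distinct (r # S @ [s])"
        using R(1) R12(1) S(1)
        by (auto simp: path_between_def successively_append_iff successively_Cons hd_append split: if_splits)
      have "successively (\<lambda>a b. {a, b} \<in> E) (A1 @ r # S @ [s])"
        using A sR(1) unfolding A12 path_between_def successively_append_iff[of _ A1] by auto
      then have A': "path_between E u s (A1 @ r # S @ [s])"
        using A A12 sR(2) R2 S(1) by (cases A1) (auto simp: path_between_def)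
      have sT: "successively (\<lambda>a b. {a, b} \<in> E) (p # T0 @ [s])"
        using less.prems(1) T
        by (auto simp: path_between_def successively_append_iff successively_Cons hd_append)
      have B': "path_between E u s (B @ T0 @ [s])"
        using B sT less.prems(1) AB(2) T
        by (cases T0) (auto simp: path_between_def successively_append_iff successively_Cons)
      have pT: "path_between E s x (s # T')"
        using less.prems(1) T by (auto simp: path_between_def successively_append_iff successively_Cons)
      have dT: "distinct T" "p \<notin> set T" using less.prems(1) by (auto simp: path_between_def)
      have I: "set (A1 @ r # S @ [s]) \<inter> set (B @ T0 @ [s]) = {u, s}"
      proof -
        have "set A1 \<union> {r} \<subseteq> set A" using A12 by auto
        moreover have "u \<in> set B" "u \<in> set A1 \<union> {r}" using AB(1) u by auto
        moreover have "set S \<inter> (set A \<union> set B) = {}" "s \<notin> set A \<union> set B" using R2 S(1) by auto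
        moreover have "set S \<inter> set T = {}" "set T0 \<subseteq> set T" using S T by auto
        ultimately show ?thesis using AB p by auto
      qed
      have J: "(set (A1 @ r # S @ [s]) \<union> set (B @ T0 @ [s])) \<inter> set T' = {}"
        using AB(2) A12 S dT T by auto
      have "u \<notin> set (s # T')" using less.prems(2) T by auto
      from less.hyps[OF _ pT this A' B' I J] T show ?thesis by simp
    qed
    show ?thesis
    proof (cases "r \<in> set A")
      case True
      show ?thesis by (rule step[OF True]) (use less.prems R12 in auto)
    next
      case False
      show ?thesis by (rule step[of B A]) (use less.prems R12 False in \<open>auto simp: Int_commute\<close>)
    qed
  qed
qed

text \<open>Menger's theorem for two paths. The push starts at the second vertex \<open>p\<close> of
  any path, where both paths are the single edge from \<open>u\<close> to \<open>p\<close>; they may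
  coincide there because only their vertices are compared.\<close>

lemma two_disjoint_paths:
  assumes "\<exists>ps. path_between E u x ps" "u \<noteq> x"
    and "\<And>y. y \<noteq> u \<Longrightarrow> y \<noteq> x \<Longrightarrow> \<exists>ps. path_between E u x ps \<and> y \<notin> set ps"
  shows "\<exists>A B. path_between E u x A \<and> path_between E u x B \<and> set A \<inter> set B = {u, x}"
proof -
  obtain ps where ps: "path_between E u x ps" using assms(1) by blast
  obtain p T where T: "ps = u # p # T"
    using ps assms(2) by (cases ps rule: remdups_adj.cases) (auto simp: path_between_def)
  show ?thesis
    by (rule two_disjoint_paths_aux[OF assms(3), of p T "[u, p]" "[u, p]"])
      (use ps T in \<open>auto simp: path_between_def successively_Cons\<close>)
qed

lemma cycle_of_two_paths:
  assumes "path_between E u x (u # A @ [x])" "path_between E u x (u # B @ [x])"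
    and "set A \<inter> set B = {}" "A \<noteq> []" "B \<noteq> []"
  shows "is_cycle E (u # A @ x # rev B)"
proof -
  let ?vs = "u # A @ x # rev B"
  have "successively (\<lambda>a b. {a, b} \<in> E) (rev (u # B @ [x]))"
    using assms(2) unfolding successively_rev by (simp add: path_between_def insert_commute)
  then have R: "successively (\<lambda>a b. {a, b} \<in> E) (x # rev B @ [u])" by simp
  have s: "successively (\<lambda>a b. {a, b} \<in> E) ?vs"
    using assms(1,4,5) R
    by (auto simp: path_between_def successively_append_iff successively_Cons hd_append)
  have l: "{last ?vs, u} \<in> E"
    using R assms(5) by (auto simp: successively_append_iff successively_Cons)
  have d: "distinct ?vs" using assms(1-3) by (auto simp: path_between_def)
  have "{?vs ! i, ?vs ! (Suc i mod length ?vs)} \<in> E" if "i < length ?vs" for i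
  proof (cases "Suc i < length ?vs")
    case True
    then show ?thesis using s by (auto simp: successively_conv_nth)
  next
    case False
    then have "Suc i = length ?vs" using that by simp
    moreover from this have "?vs ! i = last ?vs"
      by (metis diff_Suc_1 last_conv_nth list.discI)
    ultimately show ?thesis using l by (metis mod_self nth_Cons_0)
  qed
  with d show ?thesis using assms(4) unfolding is_cycle_def by (cases A) auto
qed

text \<open>If no set of at most one vertex separates the ends after deletion of their edge,
  Menger's theorem gives two internally disjoint paths between them, and the deleted edge is a chord
  of the cycle that these form.\<close>

lemma chordless_edge_separable:
  assumes "chordless E" "\<forall>e\<in>E. card e = 2"
  shows "edge_separable E"
  unfolding edge_separable_def
proof (intro allI impI)
  fix u x assume ux: "{u, x} \<in> E" "u \<noteq> x"
  show "\<exists>U W. separated E u x U W"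
  proof (rule ccontr)
    assume no: "\<not> (\<exists>U W. separated E u x U W)"
    let ?H = "E - {{u, x}}"
    \<comment> \<open>\<open>Y\<close> is empty or a single vertex. If \<open>x\<close> could not be
      reached from \<open>u\<close> outside \<open>Y\<close>, then the reached vertices together
      with \<open>Y\<close>, and the vertices not reached, would be the two sides of a
      separation.\<close>
    have path: "\<exists>ps. path_between ?H u x ps \<and> set ps \<inter> Y = {}"
      if Y: "u \<notin> Y" "x \<notin> Y" "\<forall>p\<in>Y. \<forall>q\<in>Y. p = q" for Y
    proof -
      let ?R = "{t. (u, t) \<in> {(a, b). {a, b} \<in> ?H \<and> b \<notin> Y}\<^sup>*}"
      have next_R: "b \<in> ?R \<union> Y" if "a \<in> ?R" "{a, b} \<in> ?H" for a b
        using that by (auto intro: rtrancl_into_rtrancl)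
      have "e = {u, x} \<or> e \<subseteq> ?R \<union> Y \<or> e \<subseteq> - ?R" if e: "e \<in> E" for e
      proof -
        obtain a b where "e = {a, b}" using assms(2) e by (meson card_2_iff)
        then show ?thesis using next_R[of a b] next_R[of b a] e by (auto simp: insert_commute)
      qed
      then have "x \<notin> ?R \<Longrightarrow> separated E u x (?R \<union> Y) (- ?R)"
        using Y unfolding separated_def by blast
      then have "x \<in> ?R" using no by blast
      then show ?thesis using rtrancl_path_between[of u x ?H Y] Y(1) by blast
    qed
    have "\<exists>ps. path_between ?H u x ps" using path[of "{}"] by auto
    moreover have "\<exists>ps. path_between ?H u x ps \<and> y \<notin> set ps" if "y \<noteq> u" "y \<noteq> x" for y
      using path[of "{y}"] that by auto
    ultimately obtain P Q where PQ: "path_between ?H u x P" "path_between ?H u x Q"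
      "set P \<inter> set Q = {u, x}"
      using two_disjoint_paths[of ?H u x] ux(2) by blast
    \<comment> \<open>Both paths avoid the deleted edge, so they have inner vertices; hence
      \<open>u\<close> and \<open>x\<close> are not consecutive on the cycle.\<close>
    have shape: "\<exists>A. R = u # A @ [x] \<and> A \<noteq> []" if R: "path_between ?H u x R" for R
    proof -
      obtain R' where R': "R = u # R'" "R' \<noteq> []"
        using R ux(2) by (cases R) (auto simp: path_between_def split: if_splits)
      then obtain A where "R' = A @ [x]"
        using R by (cases R' rule: rev_cases) (auto simp: path_between_def)
      with R R' show ?thesis by (auto simp: path_between_def)
    qed
    have mono: "path_between E u x R" if "path_between ?H u x R" for R
      using that unfolding path_between_def by (blast intro: successively_mono)
    obtain A B where A: "P = u # A @ [x]" "A \<noteq> []" and B: "Q = u # B @ [x]" "B \<noteq> []"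
      using shape PQ(1,2) by metis
    let ?vs = "u # A @ x # rev B"
    have "set A \<inter> set B = {}" using PQ A B by (auto simp: path_between_def)
    then have "is_cycle E ?vs" using cycle_of_two_paths mono PQ(1,2) A B by metis
    moreover have "is_chord E ?vs {u, x}"
      unfolding is_chord_def using ux A(2) B(2)
      by (intro conjI exI[of _ 0] exI[of _ "Suc (length A)"]) (auto simp: nth_append)
    ultimately show False using assms(1) unfolding chordless_def by blast
  qed
qed

section \<open>Colouring the contraction of a matching\<close>

lemma separatedI:
  assumes "u \<in> U" "u \<notin> W" "x \<in> W" "x \<notin> U"
    and "\<And>e. e \<in> E \<Longrightarrow> e = {u, x} \<or> e \<subseteq> U \<or> e \<subseteq> W"
    and "\<And>p q. p \<in> U \<Longrightarrow> p \<in> W \<Longrightarrow> q \<in> U \<Longrightarrow> q \<in> W \<Longrightarrow> p = q"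
  shows "separated E u x U W"
  using assms unfolding separated_def by simp

lemma separated_mem:
  assumes "separated E u x U W"
  shows "u \<in> U" "u \<notin> W" "x \<in> W" "x \<notin> U" "u \<noteq> x"
  using assms by (auto simp: separated_def)

lemma separated_edge: "separated E u x U W \<Longrightarrow> e \<in> E \<Longrightarrow> e = {u, x} \<or> e \<subseteq> U \<or> e \<subseteq> W"
  by (simp add: separated_def)

lemma separated_overlap:
  "separated E u x U W \<Longrightarrow> p \<in> U \<Longrightarrow> p \<in> W \<Longrightarrow> q \<in> U \<Longrightarrow> q \<in> W \<Longrightarrow> p = q"
  by (simp add: separated_def)

lemma separated_sym:
  assumes "separated E u x U W"
  shows "separated E x u W U"
proof (rule separatedI)
  fix e assume "e \<in> E"
  from separated_edge[OF assms this] show "e = {x, u} \<or> e \<subseteq> W \<or> e \<subseteq> U"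
    by (auto simp: insert_commute)
next
  fix p q assume "p \<in> W" "p \<in> U" "q \<in> W" "q \<in> U"
  then show "p = q" by (intro separated_overlap[OF assms])
qed (use separated_mem[OF assms] in simp_all)

lemma separated_subset:
  assumes "separated E u x U W" "E' \<subseteq> E"
  shows "separated E' u x U W"
  using assms by (auto simp: separated_def)

lemma edge_separable_subset: "edge_separable E \<Longrightarrow> E' \<subseteq> E \<Longrightarrow> edge_separable E'"
  unfolding edge_separable_def by (meson separated_subset subsetD)

text \<open>Each step stays within one side, so the step that leaves \<open>P\<close> must start in
  the overlap.\<close>

lemma walk_meets_overlap:
  assumes "(a, t) \<in> R\<^sup>*" "\<forall>(p, q)\<in>R. {p, q} \<subseteq> P \<or> {p, q} \<subseteq> Q" "a \<in> P" "t \<notin> P"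
  shows "\<exists>s\<in>P \<inter> Q. s \<in> Domain R"
proof (rule ccontr)
  assume no: "\<not> ?thesis"
  from assms(1) have "t \<in> P"
  proof (induction rule: rtrancl_induct)
    case (step b c)
    with assms(2) no show ?case by blast
  qed (rule assms(3))
  with assms(4) show False by blast
qed

text \<open>Otherwise the component of \<open>x\<close> within \<open>W\<close> misses
  \<open>y\<close>, so this component and its complement are disjoint sides, contrary to
  \<open>no\<close>. The connection is what justifies replacing the far side by one edge.\<close>

lemma separated_connected:
  assumes sep: "separated E u x U W" and no: "\<nexists>U W. separated E u x U W \<and> U \<inter> W = {}"
    and card2: "\<forall>e\<in>E. card e = 2" and y: "U \<inter> W = {y}"
  shows "(x, y) \<in> {(a, b). {a, b} \<in> E \<and> a \<in> W \<and> b \<in> W}\<^sup>*"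
proof (rule ccontr)
  let ?R = "{(a, b). {a, b} \<in> E \<and> a \<in> W \<and> b \<in> W}"
  let ?C = "{t. (x, t) \<in> ?R\<^sup>*}"
  assume ny: "(x, y) \<notin> ?R\<^sup>*"
  have xW: "x \<in> W" using sep by (simp add: separated_def)
  have CW: "t \<in> W" if "(x, t) \<in> ?R\<^sup>*" for t
    using that by (induction rule: rtrancl_induct) (use xW in auto)
  have ext: "b \<in> ?C" if "a \<in> ?C" "{a, b} \<in> E" "{a, b} \<noteq> {u, x}" for a b
  proof -
    have xa: "(x, a) \<in> ?R\<^sup>*" using that(1) by simp
    then have a: "a \<in> W" "a \<noteq> y" using CW[OF xa] ny by blast+
    then have "a \<notin> U" using y by blast
    then have "{a, b} \<subseteq> W" using separated_edge[OF sep that(2)] that(3) by blast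
    then have "(a, b) \<in> ?R" using that(2) by simp
    with xa have "(x, b) \<in> ?R\<^sup>*" by (rule rtrancl_into_rtrancl)
    then show ?thesis by simp
  qed
  have "e = {u, x} \<or> e \<subseteq> - ?C \<or> e \<subseteq> ?C" if e: "e \<in> E" for e
  proof -
    obtain a b where "e = {a, b}" using card2 e by (meson card_2_iff)
    then show ?thesis using ext[of a b] ext[of b a] e by (auto simp: insert_commute simp del: mem_Collect_eq)
  qed
  moreover have "u \<notin> ?C" using CW[of u] sep by (auto simp: separated_def)
  moreover have "x \<in> ?C" by simp
  ultimately have "separated E u x (- ?C) ?C"
    unfolding separated_def by blast
  then have "separated E u x (- ?C) ?C \<and> - ?C \<inter> ?C = {}" by simp
  then have "\<exists>U W. separated E u x U W \<and> U \<inter> W = {}" by (intro exI)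
  with no show False by contradiction
qed

text \<open>If \<open>u\<close> and \<open>x\<close> are separated by the vertex \<open>y\<close> after deleting the edge between them, the
  far side may be replaced by the edge \<open>x y\<close>, provided that \<open>x\<close> and \<open>y\<close> are connected in it.\<close>

lemma edge_separable_shortcut:
  assumes es: "edge_separable E" and card2: "\<forall>e\<in>E. card e = 2"
    and sep: "separated E u x U W" and y: "U \<inter> W = {y}"
    and conn: "(x, y) \<in> {(a, b). {a, b} \<in> E \<and> a \<in> W \<and> b \<in> W}\<^sup>*" and ux: "{u, x} \<in> E"
  shows "edge_separable ({e \<in> E. e \<subseteq> U} \<union> {{u, x}, {x, y}})"
proof -
  let ?E = "{e \<in> E. e \<subseteq> U} \<union> {{u, x}, {x, y}}"
  let ?R = "{(a, b). {a, b} \<in> E \<and> a \<in> W \<and> b \<in> W}"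
  have mem: "u \<in> U" "u \<notin> W" "x \<in> W" "x \<notin> U" "y \<in> U" "y \<in> W" "x \<noteq> y" "u \<noteq> y" "u \<noteq> x"
    using sep y by (auto simp: separated_def)
  have sep_ux: "separated ?E u x U {x, y}" and sep_xy: "separated ?E x y {x, u} U"
    using mem by (auto simp: separated_def)
  have old: "\<exists>P Q. separated ?E a b P Q" if ab: "{a, b} \<in> E" "{a, b} \<subseteq> U" "a \<noteq> b" for a b
  proof -
    obtain P Q where PQ: "separated E a b P Q"
      using es ab unfolding edge_separable_def by blast
    \<comment> \<open>No step inside \<open>W\<close> can use the edge between \<open>a\<close> and
      \<open>b\<close>: both ends lie in \<open>U\<close>, and the sides share only one
      vertex.\<close>
    have "{p, q} \<subseteq> P \<or> {p, q} \<subseteq> Q" if pq: "(p, q) \<in> ?R" for p q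
    proof -
      have "\<not> {a, b} \<subseteq> W" using ab(2,3) separated_overlap[OF sep, of a b] by blast
      moreover have "{p, q} \<subseteq> W" using pq by simp
      ultimately have "{p, q} \<noteq> {a, b}" by metis
      then show ?thesis using separated_edge[OF PQ, of "{p, q}"] pq by blast
    qed
    then have R: "\<forall>(p, q)\<in>?R. {p, q} \<subseteq> P \<or> {p, q} \<subseteq> Q" by blast
    have yPQ: "y \<in> P \<or> y \<in> Q"
      using conn mem(7) R by (cases rule: rtranclE) auto
    have ux_ab: "{u, x} \<noteq> {a, b}" using ab(2) mem by auto
    then have uxPQ: "{u, x} \<subseteq> P \<or> {u, x} \<subseteq> Q" using separated_edge[OF PQ ux] by blast
    \<comment> \<open>If the new edge between \<open>x\<close> and \<open>y\<close> crosses, the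
      walk in \<open>W\<close> uses up the single overlap vertex of \<open>P\<close> and
      \<open>Q\<close> outside \<open>U\<close>. So \<open>P\<close> and \<open>Q\<close> are
      disjoint on \<open>U\<close>, and \<open>x\<close> is free to become the overlap
      vertex.\<close>
    have cross: "separated ?E a b (P \<inter> (U \<union> {x})) ((Q \<inter> U) \<union> {x})"
      if PQ: "separated E a b P Q" and R: "\<forall>(p, q)\<in>?R. {p, q} \<subseteq> P \<or> {p, q} \<subseteq> Q"
        and xy: "x \<in> P" "x \<notin> Q" "y \<in> Q" "y \<notin> P" and uxPQ: "{u, x} \<subseteq> P \<or> {u, x} \<subseteq> Q"
        and ab: "{a, b} \<subseteq> U" for P Q a b
    proof -
      obtain s where s: "s \<in> P \<inter> Q" "s \<in> W"
        using walk_meets_overlap[OF conn R xy(1,4)] by auto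
      then have "s \<notin> U" using xy y by auto
      with s have "P \<inter> Q \<inter> U = {}" using separated_overlap[OF PQ] by blast
      moreover have "e = {a, b} \<or> e \<subseteq> P \<inter> (U \<union> {x}) \<or> e \<subseteq> Q \<inter> U \<union> {x}" if "e \<in> ?E" for e
        using that separated_edge[OF PQ, of e] uxPQ xy mem by blast
      ultimately show ?thesis
        using separated_mem[OF PQ] ab mem(4) xy by (intro separatedI) blast+
    qed
    have "x \<in> P \<or> x \<in> Q" using uxPQ by blast
    then consider "{x, y} \<subseteq> P \<or> {x, y} \<subseteq> Q" | "x \<in> P" "x \<notin> Q" "y \<in> Q" "y \<notin> P"
      | "x \<in> Q" "x \<notin> P" "y \<in> P" "y \<notin> Q" using yPQ by blast
    then show ?thesis
    proof cases
      case 1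
      then have "e = {a, b} \<or> e \<subseteq> P \<or> e \<subseteq> Q" if "e \<in> ?E" for e
        using that separated_edge[OF PQ, of e] uxPQ by blast
      then have "separated ?E a b P Q"
        using separated_mem[OF PQ] separated_overlap[OF PQ] by (intro separatedI)
      then show ?thesis by (intro exI)
    next
      case 2
      from cross[OF PQ R this uxPQ ab(2)] show ?thesis by (intro exI)
    next
      case 3
      have "separated ?E b a (Q \<inter> (U \<union> {x})) ((P \<inter> U) \<union> {x})"
        by (rule cross[OF separated_sym[OF PQ]]) (use R 3 uxPQ ab in auto)
      from separated_sym[OF this] show ?thesis by (intro exI)
    qed
  qed
  show ?thesis
    unfolding edge_separable_def
  proof (intro allI impI)
    fix a b assume ab: "{a, b} \<in> ?E" "a \<noteq> b"
    from ab(1) consider "{a, b} \<in> E" "{a, b} \<subseteq> U" | "{a, b} = {u, x}" | "{a, b} = {x, y}"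
      by (simp only: Un_iff mem_Collect_eq insert_iff empty_iff) metis
    then show "\<exists>P Q. separated ?E a b P Q"
    proof cases
      case 1
      then show ?thesis by (rule old) (rule ab(2))
    next
      case 2
      then have "a = u \<and> b = x \<or> a = x \<and> b = u" by (simp add: doubleton_eq_iff)
      then show ?thesis
        by (elim disjE conjE; hypsubst) (rule exI, rule exI, rule sep_ux separated_sym[OF sep_ux])+
    next
      case 3
      then have "a = x \<and> b = y \<or> a = y \<and> b = x" by (simp add: doubleton_eq_iff)
      then show ?thesis
        by (elim disjE conjE; hypsubst) (rule exI, rule exI, rule sep_xy separated_sym[OF sep_xy])+
    qed
  qed
qed

section \<open>Colourings of a contraction: permuting, gluing, extending\<close>

definition matching :: "'a set set \<Rightarrow> bool" where
  "matching M \<longleftrightarrow> (\<forall>e\<in>M. \<forall>f\<in>M. e \<noteq> f \<longrightarrow> e \<inter> f = {})"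

text \<open>A proper 3-colouring of the graph obtained from \<open>E\<close> by contracting the edges in \<open>M\<close>.\<close>

definition contracted_colouring :: "'a set set \<Rightarrow> 'a set set \<Rightarrow> ('a \<Rightarrow> nat) \<Rightarrow> bool" where
  "contracted_colouring E M c \<longleftrightarrow> (\<forall>v. c v < 3) \<and>
     (\<forall>p q. {p, q} \<in> E \<longrightarrow> p \<noteq> q \<longrightarrow> (c p = c q \<longleftrightarrow> {p, q} \<in> M))"

lemma permute_three:
  assumes "a < 3" "b < 3" "a \<noteq> b" "a' < 3" "b' < 3" "a' \<noteq> b'"
  shows "\<exists>\<pi>. inj_on \<pi> {..<3::nat} \<and> (\<forall>z<3. \<pi> z < (3::nat)) \<and> \<pi> a = a' \<and> \<pi> b = b'"
proof (intro exI conjI)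
  \<comment> \<open>The three colours add up to 3, so \<open>3 - a' - b'\<close> is the remaining
    one.\<close>
  let ?\<pi> = "\<lambda>z. if z = a then a' else if z = b then b' else 3 - a' - b'"
  show "inj_on ?\<pi> {..<3}"
  proof (rule inj_onI)
    fix s t assume "s \<in> {..<3}" "t \<in> {..<3}" "?\<pi> s = ?\<pi> t"
    then show "s = t" using assms by (simp split: if_splits) presburger+
  qed
  show "\<forall>z<3. ?\<pi> z < 3" using assms(4-6) by presburger
qed (use assms(3) in simp_all)

lemma contracted_colouring_permute:
  assumes "contracted_colouring E M c" "inj_on \<pi> {..<3}" "\<forall>z<3. \<pi> z < 3"
  shows "contracted_colouring E M (\<pi> \<circ> c)"
  using assms unfolding contracted_colouring_def by (simp add: inj_on_eq_iff)

text \<open>Used to make the colours of one side of a separation fit those of the other at two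
  vertices at once.\<close>

lemma contracted_colouring_normalise:
  assumes "contracted_colouring E M c" "c p \<noteq> c q" "a < 3" "b < 3" "a \<noteq> b"
  shows "\<exists>c'. contracted_colouring E M c' \<and> c' p = a \<and> c' q = b"
proof -
  obtain \<pi> where "inj_on \<pi> {..<3::nat}" "\<forall>z<3. \<pi> z < (3::nat)" "\<pi> (c p) = a" "\<pi> (c q) = b"
    using permute_three[of "c p" "c q" a b] assms unfolding contracted_colouring_def by auto
  then show ?thesis using contracted_colouring_permute[OF assms(1)] by fastforce
qed

lemma contracted_colouring_glue:
  assumes sep: "separated E u x U W"
    and c1: "contracted_colouring {e \<in> E. e \<subseteq> U} M c\<^sub>1"
    and c2: "contracted_colouring {e \<in> E. e \<subseteq> W} M c\<^sub>2"
    and eq: "\<forall>p\<in>U \<inter> W. c\<^sub>1 p = c\<^sub>2 p" and ux: "c\<^sub>1 u = c\<^sub>2 x \<longleftrightarrow> {u, x} \<in> M"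
  shows "contracted_colouring E M (\<lambda>v. if v \<in> U then c\<^sub>1 v else c\<^sub>2 v)" (is "contracted_colouring E M ?c")
proof -
  have W: "?c v = c\<^sub>2 v" if "v \<in> W" for v using eq that by auto
  have "?c p = ?c q \<longleftrightarrow> {p, q} \<in> M" if pq: "{p, q} \<in> E" "p \<noteq> q" for p q
  proof -
    have "{p, q} = {u, x} \<or> {p, q} \<subseteq> U \<or> {p, q} \<subseteq> W"
      using sep pq(1) unfolding separated_def by (elim conjE bspec)
    then consider "{p, q} = {u, x}" | "{p, q} \<subseteq> U" | "{p, q} \<subseteq> W" by blast
    then show ?thesis
    proof cases
      case 1
      then show ?thesis using ux sep by (auto simp: separated_def doubleton_eq_iff insert_commute)
    next
      case 2
      then show ?thesis using c1 pq by (simp add: contracted_colouring_def)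
    next
      case 3
      then show ?thesis using c2 pq W[of p] W[of q] by (simp add: contracted_colouring_def)
    qed
  qed
  then show ?thesis using c1 c2 by (simp add: contracted_colouring_def)
qed

lemma contracted_colouring_mono:
  assumes "contracted_colouring E' M' c" "E \<subseteq> E'" "\<forall>e\<in>E. e \<in> M \<longleftrightarrow> e \<in> M'"
  shows "contracted_colouring E M c"
  using assms unfolding contracted_colouring_def by blast

text \<open>The greedy step: \<open>K\<close> is a single vertex of the contraction, either an
  unmatched vertex or an edge of \<open>M\<close>, and the at most two edges leaving it block at
  most two of the three colours.\<close>

lemma contracted_colouring_extend:
  assumes c: "contracted_colouring {e \<in> E. e \<inter> K = {}} M c"
    and card2: "\<forall>e\<in>E. card e = 2" and fin: "finite E"
    and K: "\<forall>e\<in>E. e \<subseteq> K \<longrightarrow> e \<in> M" "\<forall>e\<in>M. e \<inter> K \<noteq> {} \<longrightarrow> e \<subseteq> K"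
    and ext: "card {e \<in> E. e \<inter> K \<noteq> {} \<and> \<not> e \<subseteq> K} \<le> 2"
  shows "\<exists>c. contracted_colouring E M c"
proof -
  let ?X = "{e \<in> E. e \<inter> K \<noteq> {} \<and> \<not> e \<subseteq> K}"
  \<comment> \<open>The colour at the end of \<open>e\<close> outside \<open>K\<close>; this end is
    unique for the edges in \<open>?X\<close>.\<close>
  let ?f = "\<lambda>e. c (THE v. v \<in> e - K)"
  have "card (?f ` ?X) < card {..<3::nat}"
    using card_image_le[of ?X ?f] ext fin by simp
  then have "\<not> {..<3} \<subseteq> ?f ` ?X"
    by (metis (no_types, lifting) card_mono fin finite_imageI finite_subset leD mem_Collect_eq subsetI)
  then obtain t where t: "t < 3" "t \<notin> ?f ` ?X" by blast
  let ?c = "\<lambda>v. if v \<in> K then t else c v"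
  have X: "c q \<noteq> t" "{p, q} \<notin> M" if "{p, q} \<in> E" "p \<in> K" "q \<notin> K" for p q
  proof -
    have "(THE v. v \<in> {p, q} - K) = q" using that by auto
    then have "c q = ?f {p, q}" by simp
    moreover have "{p, q} \<in> ?X" using that by simp
    ultimately have "c q \<in> ?f ` ?X" by (rule image_eqI)
    then show "c q \<noteq> t" using t(2) by metis
    show "{p, q} \<notin> M" using K(2) that by auto
  qed
  have "?c p = ?c q \<longleftrightarrow> {p, q} \<in> M" if pq: "{p, q} \<in> E" "p \<noteq> q" for p q
  proof -
    have qp: "{q, p} \<in> E" "{q, p} = {p, q}" using pq by (auto simp: insert_commute)
    consider "p \<in> K" "q \<in> K" | "p \<in> K" "q \<notin> K" | "p \<notin> K" "q \<in> K" | "p \<notin> K" "q \<notin> K" by blast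
    then show ?thesis
    proof cases
      case 1
      then show ?thesis using K(1) pq by simp
    next
      case 4
      then show ?thesis using c pq by (simp add: contracted_colouring_def)
    qed (use X[of p q] X[of q p] pq qp in auto)
  qed
  then have "contracted_colouring E M ?c" using c t(1) by (simp add: contracted_colouring_def)
  then show ?thesis by blast
qed

lemma matching_subset: "matching M \<Longrightarrow> M' \<subseteq> M \<Longrightarrow> matching M'"
  by (auto simp: matching_def)

lemma matching_unique: "matching M \<Longrightarrow> e \<in> M \<Longrightarrow> f \<in> M \<Longrightarrow> v \<in> e \<Longrightarrow> v \<in> f \<Longrightarrow> e = f"
  by (auto simp: matching_def)

lemma matching_insert:
  assumes "matching M" "\<And>m. m \<in> M \<Longrightarrow> m \<inter> e = {}"
  shows "matching (insert e M)"
  unfolding matching_def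
proof (intro ballI impI)
  fix f g assume "f \<in> insert e M" "g \<in> insert e M" "f \<noteq> g"
  then consider "f \<in> M" "g \<in> M" | "f = e" "g \<in> M" | "f \<in> M" "g = e" by blast
  then show "f \<inter> g = {}"
    by cases (use assms \<open>f \<noteq> g\<close> in \<open>auto simp: matching_def Int_commute[of e]\<close>)
qed

section \<open>Counting in contractions of minimum degree 3\<close>

lemma three_at_vertex:
  assumes "finite E" "e \<in> E" "f \<in> E" "g \<in> E" "v \<in> e" "v \<in> f" "v \<in> g" "e \<noteq> f" "e \<noteq> g" "f \<noteq> g"
  shows "3 \<le> vertex_degree E v"
proof -
  have "card {e, f, g} \<le> card {e \<in> E. v \<in> e}"
    using assms by (intro card_mono) auto
  then show ?thesis using assms(8-10) by (simp add: vertex_degree_def)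
qed

text \<open>If the contraction of \<open>M\<close> has minimum degree 3 and \<open>E\<close> has no edge between two vertices of
  degree at least 3, then every edge outside \<open>M\<close> has an end of degree 2 matched by \<open>M\<close>, so the
  contraction has at most as many edges as vertices, a contradiction.\<close>

lemma adjacent_large_degrees:
  assumes fin: "finite E" and card2: "\<forall>e\<in>E. card e = 2" and M: "M \<subseteq> E" "matching M" and "E \<noteq> {}"
    and unmatched: "\<forall>e\<in>E. \<forall>v\<in>e. v \<notin> \<Union>M \<longrightarrow> 3 \<le> vertex_degree E v"
    and ext: "\<forall>m\<in>M. 3 \<le> card {e \<in> E - M. e \<inter> m \<noteq> {}}"
  shows "\<exists>u x. {u, x} \<in> E \<and> u \<noteq> x \<and> 3 \<le> vertex_degree E u \<and> 3 \<le> vertex_degree E x"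
proof (rule ccontr)
  assume no: "\<not> ?thesis"
  let ?X = "E - M"
  have finM: "finite M" using M(1) fin by (rule finite_subset)
  have "\<exists>v m. v \<in> e \<and> vertex_degree E v < 3 \<and> m \<in> M \<and> v \<in> m" if e: "e \<in> ?X" for e
  proof -
    obtain a b where "e = {a, b}" "a \<noteq> b" using card2 e by (metis DiffD1 card_2_iff)
    with no e obtain v where "v \<in> e" "vertex_degree E v < 3" by (metis DiffD1 insertCI not_less)
    then show ?thesis using unmatched e by (metis DiffD1 UnionE not_less)
  qed
  then obtain v m where vm: "\<And>e. e \<in> ?X \<Longrightarrow> v e \<in> e \<and> vertex_degree E (v e) < 3 \<and> m e \<in> M \<and> v e \<in> m e"
    by metis
  \<comment> \<open>One of the at most two edges at such a vertex belongs to \<open>M\<close>, which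
    leaves room for only one edge outside \<open>M\<close>.\<close>
  have same: "e = f" if "e \<in> ?X" "f \<in> ?X" "w \<in> e" "w \<in> f" "m \<in> M" "w \<in> m" "vertex_degree E w < 3" for e f m w
    using three_at_vertex[OF fin, of e f m w] that M(1) by (metis DiffD1 DiffD2 not_less subsetD)
  \<comment> \<open>If two edges are sent to the same member of \<open>M\<close> through different
    ends, both of its ends have degree below 3. Then only these two edges leave it, contrary to
    \<open>ext\<close>.\<close>
  have "inj_on m ?X"
  proof (rule inj_onI)
    fix e f assume ef: "e \<in> ?X" "f \<in> ?X" "m e = m f"
    show "e = f"
    proof (cases "v e = v f")
      case True
      then show ?thesis using same[of e f "v e" "m e"] vm[of e] vm[of f] ef by simp
    next
      case False
      have mE: "m e \<in> M" "m e \<in> E" using vm ef(1) M(1) by blast+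
      have "v e \<in> m e" "v f \<in> m e" using vm ef by auto
      with False mE card2 have me: "m e = {v e, v f}"
        by (metis (no_types, lifting) card_2_iff doubleton_eq_iff insert_iff singletonD)
      have "g = e \<or> g = f" if g: "g \<in> ?X" "g \<inter> m e \<noteq> {}" for g
        using g me same[of g e "v e" "m e"] same[of g f "v f" "m e"] vm[of e] vm[of f] ef by auto
      then have "{g \<in> ?X. g \<inter> m e \<noteq> {}} \<subseteq> {e, f}" by blast
      then have "card {g \<in> ?X. g \<inter> m e \<noteq> {}} \<le> card {e, f}" by (intro card_mono) auto
      also have "\<dots> \<le> 2" by (simp add: card_insert_if)
      finally show ?thesis using ext mE(1) by fastforce
    qed
  qed
  moreover have "m ` ?X \<subseteq> M" using vm by blast
  ultimately have XM: "card ?X \<le> card M" using finM by (rule card_inj_on_le)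
  have two: "card {m \<in> M. e \<inter> m \<noteq> {}} \<le> 2" if e: "e \<in> ?X" for e
  proof -
    obtain a b where ab: "e = {a, b}" using card2 e by (metis DiffD1 card_2_iff)
    have one: "card {m \<in> M. w \<in> m} \<le> 1" for w
      using matching_unique[OF M(2)] finM by (auto simp: card_le_Suc0_iff_eq)
    have "{m \<in> M. e \<inter> m \<noteq> {}} \<subseteq> {m \<in> M. a \<in> m} \<union> {m \<in> M. b \<in> m}" using ab by auto
    then have "card {m \<in> M. e \<inter> m \<noteq> {}} \<le> card ({m \<in> M. a \<in> m} \<union> {m \<in> M. b \<in> m})"
      using finM by (intro card_mono) auto
    also have "\<dots> \<le> card {m \<in> M. a \<in> m} + card {m \<in> M. b \<in> m}" by (rule card_Un_le)
    finally show ?thesis using one[of a] one[of b] by simp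
  qed
  \<comment> \<open>Double counting of incidences between \<open>M\<close> and \<open>?X\<close>:
    each member of \<open>M\<close> meets at least three edges of \<open>?X\<close>, each edge of
    \<open>?X\<close> meets at most two members of \<open>M\<close>. Together with injectivity, 3
    |M| is at most 2 |X|, which is at most 2 |M|.\<close>
  have "3 * card M = (\<Sum>m\<in>M. 3)" by simp
  also have "\<dots> \<le> (\<Sum>m\<in>M. card {e \<in> ?X. e \<inter> m \<noteq> {}})" using ext by (intro sum_mono) blast
  also have "\<dots> = (\<Sum>m\<in>M. \<Sum>e\<in>{e \<in> ?X. e \<inter> m \<noteq> {}}. 1)" by simp
  also have "\<dots> = (\<Sum>e\<in>?X. \<Sum>m\<in>{m \<in> M. e \<inter> m \<noteq> {}}. 1)"
    using finM fin by (intro sum.swap_restrict) auto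
  also have "\<dots> \<le> (\<Sum>e\<in>?X. 2)" using two by (intro sum_mono) simp
  also have "\<dots> = 2 * card ?X" by simp
  finally have "card M = 0" "card ?X = 0" using XM by auto
  then have "E = {}" using finM fin by auto
  with \<open>E \<noteq> {}\<close> show False by simp
qed

section \<open>Splitting at an edge between vertices of degree at least 3\<close>

lemma separated_card:
  assumes "finite E" and sep: "separated E u x U W" "{u, x} \<in> E" "\<forall>e\<in>E. card e = 2"
  shows "card E = Suc (card {e \<in> E. e \<subseteq> U} + card {e \<in> E. e \<subseteq> W})"
    and "vertex_degree E u \<le> Suc (card {e \<in> E. e \<subseteq> U})"
proof -
  note mem = separated_mem[OF sep(1)]
  have disj: "\<not> e \<subseteq> W" if e: "e \<in> E" "e \<subseteq> U" for e
  proof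
    assume "e \<subseteq> W"
    then have "p = q" if "p \<in> e" "q \<in> e" for p q
      using that e(2) separated_overlap[OF sep(1), of p q] by blast
    moreover obtain p q where "e = {p, q}" "p \<noteq> q" using sep(3) e(1) by (metis card_2_iff)
    ultimately show False by blast
  qed
  have E: "E = insert {u, x} ({e \<in> E. e \<subseteq> U} \<union> {e \<in> E. e \<subseteq> W})"
    using separated_edge[OF sep(1)] sep(2) by blast
  have "{u, x} \<notin> {e \<in> E. e \<subseteq> U} \<union> {e \<in> E. e \<subseteq> W}" using mem by auto
  then show "card E = Suc (card {e \<in> E. e \<subseteq> U} + card {e \<in> E. e \<subseteq> W})"
    using assms(1) disj by (subst E, subst card_insert_disjoint) (auto intro!: card_Un_disjoint)
  have "{e \<in> E. u \<in> e} \<subseteq> insert {u, x} {e \<in> E. e \<subseteq> U}"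
    using separated_edge[OF sep(1)] mem by blast
  then have "vertex_degree E u \<le> card (insert {u, x} {e \<in> E. e \<subseteq> U})"
    unfolding vertex_degree_def using assms(1) by (intro card_mono) auto
  also have "\<dots> \<le> Suc (card {e \<in> E. e \<subseteq> U})" using assms(1) by (simp add: card_insert_if)
  finally show "vertex_degree E u \<le> Suc (card {e \<in> E. e \<subseteq> U})" .
qed

lemma separated_sides:
  assumes "separated E u x U W" "{u, x} \<in> E"
  shows "{e \<in> E. e \<subseteq> U} \<subset> E" "{e \<in> E. e \<subseteq> W} \<subset> E"
proof -
  have "{u, x} \<notin> {e \<in> E. e \<subseteq> U}" "{u, x} \<notin> {e \<in> E. e \<subseteq> W}"
    using separated_mem[OF assms(1)] by simp_all
  moreover have "{e \<in> E. e \<subseteq> Z} \<subseteq> E" for Z by auto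
  ultimately show "{e \<in> E. e \<subseteq> U} \<subset> E" "{e \<in> E. e \<subseteq> W} \<subset> E"
    using assms(2) by (metis psubsetI)+
qed

lemma third_colour:
  assumes "a < (3::nat)" "b < (3::nat)"
  shows "\<exists>t<3. t \<noteq> a \<and> t \<noteq> b"
proof -
  have "card {a, b} < card {..<3::nat}" by (simp add: card_insert_if)
  then have "\<not> {..<3} \<subseteq> {a, b}" by (metis card_mono finite.emptyI finite_insert leD)
  then show ?thesis by blast
qed

text \<open>The purpose of the added edge between \<open>x\<close> and \<open>y\<close>: next to the
  contracted edge it makes the common colour of \<open>u\<close> and \<open>x\<close> differ from
  that of \<open>y\<close>.\<close>

lemma matched_separation:
  assumes M: "matching M" "{u, x} \<in> M" and u: "u \<in> U" "x \<notin> U" "u \<noteq> y" "x \<noteq> y" and "u \<noteq> x"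
    and c: "contracted_colouring ({e \<in> E. e \<subseteq> U} \<union> {{u, x}, {x, y}}) (insert {u, x} {m \<in> M. m \<subseteq> U}) c"
  shows "c u = c x" "c x \<noteq> c y"
proof -
  have "{x, y} \<noteq> {u, x}" using u by (auto simp: doubleton_eq_iff)
  then have "{x, y} \<notin> insert {u, x} {m \<in> M. m \<subseteq> U}" using u by auto
  then show "c x \<noteq> c y" using c u(4) unfolding contracted_colouring_def by blast
  show "c u = c x" using c \<open>u \<noteq> x\<close> unfolding contracted_colouring_def by blast
qed

text \<open>The sides are disjoint, so the colours on \<open>W\<close> may be permuted at will; only
  the colour of \<open>x\<close> has to fit that of \<open>u\<close>.\<close>

lemma contracted_colouring_bridge:
  assumes sep: "separated E u x U W" "U \<inter> W = {}"
    and c1: "contracted_colouring {e \<in> E. e \<subseteq> U} M c\<^sub>1"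
    and c2: "contracted_colouring {e \<in> E. e \<subseteq> W} M c\<^sub>2"
  shows "\<exists>c. contracted_colouring E M c"
proof -
  have c3: "c\<^sub>1 u < 3" "c\<^sub>2 x < 3" using c1 c2 by (auto simp: contracted_colouring_def)
  obtain t where t: "t < 3" "t = c\<^sub>1 u \<longleftrightarrow> {u, x} \<in> M"
    using c3 third_colour[of "c\<^sub>1 u" "c\<^sub>1 u"] by (cases "{u, x} \<in> M") auto
  obtain s t' where s: "s < 3" "s \<noteq> c\<^sub>2 x" "t' < 3" "t' \<noteq> t"
    using third_colour[of "c\<^sub>2 x" t] c3 t(1) by blast
  obtain \<pi> where \<pi>: "inj_on \<pi> {..<3::nat}" "\<forall>z<3. \<pi> z < (3::nat)" "\<pi> (c\<^sub>2 x) = t"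
    using permute_three[of "c\<^sub>2 x" s t t'] c3 t s by auto
  have "contracted_colouring E M (\<lambda>v. if v \<in> U then c\<^sub>1 v else (\<pi> \<circ> c\<^sub>2) v)"
    by (rule contracted_colouring_glue[OF sep(1) c1 contracted_colouring_permute[OF c2 \<pi>(1,2)]])
      (use sep(2) \<pi>(3) t(2) in auto)
  then show ?thesis by blast
qed

text \<open>The far side is coloured together with the path \<open>x u y\<close> whose second edge is contracted,
  which forces distinct colours on \<open>x\<close> and \<open>y\<close>.\<close>

lemma contracted_colouring_unmatched_cut:
  assumes sep: "separated E u x U W" and y: "U \<inter> W = {y}"
    and M: "matching M" "{u, x} \<notin> M" and yW: "\<forall>m\<in>M. m \<subseteq> W \<longrightarrow> y \<notin> m"
    and c1: "contracted_colouring {e \<in> E. e \<subseteq> U} M c\<^sub>1"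
    and IH: "\<And>M'. matching M' \<Longrightarrow>
      \<exists>c. contracted_colouring ({e \<in> E. e \<subseteq> W} \<union> {{x, u}, {u, y}}) M' c"
  shows "\<exists>c. contracted_colouring E M c"
proof -
  note mem = separated_mem[OF sep]
  have xy: "x \<noteq> y" "u \<noteq> y" "y \<in> U" "y \<in> W" using mem y by auto
  \<comment> \<open>By \<open>yW\<close> the vertex \<open>y\<close> is unmatched within
    \<open>W\<close>, so the new edge between \<open>u\<close> and \<open>y\<close> can join the
    matching.\<close>
  have "matching (insert {u, y} {m \<in> M. m \<subseteq> W})"
    by (rule matching_insert) (use M(1) yW mem in \<open>auto intro: matching_subset\<close>)
  from IH[OF this] obtain c\<^sub>2 where c2: "contracted_colouring ({e \<in> E. e \<subseteq> W} \<union> {{x, u}, {u, y}})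
      (insert {u, y} {m \<in> M. m \<subseteq> W}) c\<^sub>2" by blast
  have "{x, u} \<notin> insert {u, y} {m \<in> M. m \<subseteq> W}" using xy mem by (auto simp: doubleton_eq_iff)
  with c2 mem(5) have "c\<^sub>2 x \<noteq> c\<^sub>2 u" unfolding contracted_colouring_def by blast
  moreover have "c\<^sub>2 u = c\<^sub>2 y" using c2 xy(2) unfolding contracted_colouring_def by blast
  ultimately have ne: "c\<^sub>2 y \<noteq> c\<^sub>2 x" by simp
  have c3: "c\<^sub>1 v < 3" for v using c1 by (auto simp: contracted_colouring_def)
  \<comment> \<open>The future colour of \<open>x\<close>: it avoids that of \<open>u\<close>
    because the edge between them is not contracted, and that of \<open>y\<close> because the far
    side distinguishes \<open>x\<close> from \<open>y\<close>.\<close>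
  obtain t where t: "t < 3" "t \<noteq> c\<^sub>1 y" "t \<noteq> c\<^sub>1 u" using third_colour c3 by metis
  have "\<forall>e\<in>{e \<in> E. e \<subseteq> W}. e \<in> M \<longleftrightarrow>
      e \<in> insert {u, y} {m \<in> M. m \<subseteq> W}" using mem by auto
  then have "contracted_colouring {e \<in> E. e \<subseteq> W} M c\<^sub>2"
    by (intro contracted_colouring_mono[OF c2]) auto
  from contracted_colouring_normalise[OF this ne c3 t(1) t(2)[symmetric]]
  obtain c\<^sub>3 where c3: "contracted_colouring {e \<in> E. e \<subseteq> W} M c\<^sub>3" "c\<^sub>3 y = c\<^sub>1 y" "c\<^sub>3 x = t" by blast
  have "contracted_colouring E M (\<lambda>v. if v \<in> U then c\<^sub>1 v else c\<^sub>3 v)"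
    by (rule contracted_colouring_glue[OF sep c1 c3(1)]) (use y c3 t M(2) in auto)
  then show ?thesis by blast
qed

text \<open>Each side is coloured with a copy of the contracted edge and an edge from it to
  \<open>y\<close>. Thus both colourings distinguish the contracted edge from \<open>y\<close>, and
  one permutation makes them agree on both.\<close>

lemma contracted_colouring_matched_cut:
  assumes sep: "separated E u x U W" and y: "U \<inter> W = {y}"
    and M: "matching M" "{u, x} \<in> M"
    and IH1: "\<And>M'. matching M' \<Longrightarrow>
      \<exists>c. contracted_colouring ({e \<in> E. e \<subseteq> U} \<union> {{u, x}, {x, y}}) M' c"
    and IH2: "\<And>M'. matching M' \<Longrightarrow>
      \<exists>c. contracted_colouring ({e \<in> E. e \<subseteq> W} \<union> {{x, u}, {u, y}}) M' c"
  shows "\<exists>c. contracted_colouring E M c"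
proof -
  note mem = separated_mem[OF sep]
  have xy: "x \<noteq> y" "u \<noteq> y" "y \<in> U" "y \<in> W" using mem y by auto
  have M': "insert {u, x} {m \<in> M. m \<subseteq> Z} \<subseteq> M" for Z using M(2) by auto
  have xu: "{x, u} = {u, x}" by (rule insert_commute)
  from IH1[OF matching_subset[OF M(1) M'[of U]]] obtain c\<^sub>1 where
    c1: "contracted_colouring ({e \<in> E. e \<subseteq> U} \<union> {{u, x}, {x, y}}) (insert {u, x} {m \<in> M. m \<subseteq> U}) c\<^sub>1"
    by blast
  from IH2[OF matching_subset[OF M(1) M'[of W]]] obtain c\<^sub>2 where
    c2: "contracted_colouring ({e \<in> E. e \<subseteq> W} \<union> {{x, u}, {u, y}}) (insert {x, u} {m \<in> M. m \<subseteq> W}) c\<^sub>2"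
    unfolding xu by blast
  have d1: "c\<^sub>1 u = c\<^sub>1 x" "c\<^sub>1 x \<noteq> c\<^sub>1 y"
    using matched_separation[OF M mem(1,4) xy(2,1) mem(5) c1] by auto
  have d2: "c\<^sub>2 x = c\<^sub>2 u" "c\<^sub>2 u \<noteq> c\<^sub>2 y"
    using matched_separation[of M x u W y, OF M(1) _ mem(3,2) xy(1,2) mem(5)[symmetric] c2] M(2)
    unfolding xu by auto
  have r1: "contracted_colouring {e \<in> E. e \<subseteq> U} M c\<^sub>1"
    by (rule contracted_colouring_mono[OF c1]) (use M(2) in auto)
  have r2: "contracted_colouring {e \<in> E. e \<subseteq> W} M c\<^sub>2"
    by (rule contracted_colouring_mono[OF c2]) (use M(2) xu in auto)
  have lt: "c\<^sub>1 v < 3" for v using c1 by (auto simp: contracted_colouring_def)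
  have "c\<^sub>2 y \<noteq> c\<^sub>2 x" "c\<^sub>1 y \<noteq> c\<^sub>1 u" using d1 d2 by auto
  from contracted_colouring_normalise[OF r2 this(1) lt lt this(2)]
  obtain c\<^sub>3 where c3: "contracted_colouring {e \<in> E. e \<subseteq> W} M c\<^sub>3" "c\<^sub>3 y = c\<^sub>1 y" "c\<^sub>3 x = c\<^sub>1 u" by blast
  have "contracted_colouring E M (\<lambda>v. if v \<in> U then c\<^sub>1 v else c\<^sub>3 v)"
    by (rule contracted_colouring_glue[OF sep r1 c3(1)]) (use y c3 M(2) in auto)
  then show ?thesis by blast
qed

text \<open>Induction on the number of edges, for all matchings at once, because the shortcuts
  change the matching too.\<close>

lemma matching_contraction_3_colourable:
  fixes E :: "'a set set"
  assumes "finite E" "\<forall>e\<in>E. card e = 2" "edge_separable E" "matching M" "M \<subseteq> E"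
  shows "\<exists>c. contracted_colouring E M c"
  using assms
proof (induction "card E" arbitrary: E M rule: less_induct)
  case less
  note fin = less.prems(1) and card2 = less.prems(2) and es = less.prems(3) and M = less.prems(4)
    and ME = less.prems(5)
  have IH: "\<exists>c. contracted_colouring E' M' c"
    if "card E' < card E" "finite E'" "\<forall>e\<in>E'. card e = 2" "edge_separable E'" "matching M'" for E' M' :: "'a set set"
  proof -
    have "matching (M' \<inter> E')" using that(5) by (rule matching_subset) simp
    from less.hyps[OF that(1-4) this] obtain c where "contracted_colouring E' (M' \<inter> E') c" by auto
    then have "contracted_colouring E' M' c" by (rule contracted_colouring_mono) auto
    then show ?thesis by blast
  qed
  have sub: "\<exists>c. contracted_colouring E' M' c" if "E' \<subset> E" "matching M'" for E' M' :: "'a set set"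
    using that fin card2 es
    by (intro IH psubset_card_mono) (auto intro: finite_subset edge_separable_subset)
  consider (empty) "E = {}" | (adj) u x where "{u, x} \<in> E" "u \<noteq> x" "3 \<le> vertex_degree E u" "3 \<le> vertex_degree E x"
    | (sparse) "E \<noteq> {}" "\<nexists>u x. {u, x} \<in> E \<and> u \<noteq> x \<and> 3 \<le> vertex_degree E u \<and> 3 \<le> vertex_degree E x" by blast
  then show ?case
  proof cases
    case empty
    then show ?thesis by (intro exI[of _ "\<lambda>_. 0"]) (simp add: contracted_colouring_def)
  next
    case sparse
    have reduce: ?thesis if K: "\<forall>e\<in>E. e \<subseteq> K \<longrightarrow> e \<in> M" "\<forall>e\<in>M. e \<inter> K \<noteq> {} \<longrightarrow> e \<subseteq> K"
      "card {e \<in> E. e \<inter> K \<noteq> {} \<and> \<not> e \<subseteq> K} \<le> 2" "e\<^sub>0 \<in> E" "e\<^sub>0 \<inter> K \<noteq> {}" for K e\<^sub>0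
    proof -
      have "{e \<in> E. e \<inter> K = {}} \<subset> E" using K(4,5) by blast
      from sub[OF this M] obtain c where "contracted_colouring {e \<in> E. e \<inter> K = {}} M c" by blast
      then show ?thesis by (rule contracted_colouring_extend[OF _ card2 fin K(1-3)])
    qed
    \<comment> \<open>By the counting lemma some vertex of the contraction, an unmatched vertex or
      an edge of \<open>M\<close>, is left by at most two edges. It is removed and coloured
      last.\<close>
    have "(\<exists>e\<in>E. \<exists>v\<in>e. v \<notin> \<Union>M \<and> vertex_degree E v < 3) \<or>
        (\<exists>m\<in>M. card {e \<in> E - M. e \<inter> m \<noteq> {}} < 3)"
      using adjacent_large_degrees[OF fin card2 ME M sparse(1)] sparse(2) by (meson not_less)
    then show ?thesis
    proof
      assume "\<exists>e\<in>E. \<exists>v\<in>e. v \<notin> \<Union>M \<and> vertex_degree E v < 3"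
      then obtain e v where ev: "e \<in> E" "v \<in> e" "v \<notin> \<Union>M" "vertex_degree E v < 3" by blast
      have "\<not> f \<subseteq> {v}" if "f \<in> E" for f
        using card2 that card_mono[of "{v}" f] by fastforce
      moreover have "card {f \<in> E. f \<inter> {v} \<noteq> {} \<and> \<not> f \<subseteq> {v}} \<le> card {f \<in> E. v \<in> f}"
        using fin by (intro card_mono) auto
      ultimately show ?thesis
        using ev by (intro reduce[of "{v}" e]) (auto simp: vertex_degree_def)
    next
      assume "\<exists>m\<in>M. card {e \<in> E - M. e \<inter> m \<noteq> {}} < 3"
      then obtain m where m: "m \<in> M" "card {e \<in> E - M. e \<inter> m \<noteq> {}} < 3" by blast
      have inside: "e = m" if "e \<in> E" "e \<subseteq> m" for e
        using card2 that m(1) ME card_subset_eq[of m e] card_ge_0_finite[of m] by auto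
      have touch: "e = m" if "e \<in> M" "e \<inter> m \<noteq> {}" for e
        using M that m(1) unfolding matching_def by blast
      have "{e \<in> E. e \<inter> m \<noteq> {} \<and> \<not> e \<subseteq> m} \<subseteq> {e \<in> E - M. e \<inter> m \<noteq> {}}"
        using touch by blast
      then have "card {e \<in> E. e \<inter> m \<noteq> {} \<and> \<not> e \<subseteq> m} \<le> card {e \<in> E - M. e \<inter> m \<noteq> {}}"
        using fin by (intro card_mono) auto
      moreover have "m \<noteq> {}" using m(1) ME card2 by fastforce
      ultimately show ?thesis
        using m ME inside touch by (intro reduce[of m m]) auto
    qed
  next
    case adj
    show ?thesis
    proof (cases "\<exists>U W. separated E u x U W \<and> U \<inter> W = {}")
      case True
      then obtain U W where sep: "separated E u x U W" "U \<inter> W = {}" by blast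
      note strict = separated_sides[OF sep(1) adj(1)]
      from sub[OF strict(1) M] sub[OF strict(2) M] obtain c\<^sub>1 c\<^sub>2 where
        "contracted_colouring {e \<in> E. e \<subseteq> U} M c\<^sub>1"
        "contracted_colouring {e \<in> E. e \<subseteq> W} M c\<^sub>2" by (elim exE)
      then show ?thesis by (rule contracted_colouring_bridge[OF sep])
    next
      case False
      obtain U W where sep: "separated E u x U W"
        using es adj(1,2) unfolding edge_separable_def by blast
      have "U \<inter> W \<noteq> {}" using False sep by blast
      then obtain y where y: "U \<inter> W = {y}" using separated_overlap[OF sep] by blast
      note mem = separated_mem[OF sep]
      have y': "W \<inter> U = {y}" and xu: "{x, u} \<in> E" using y adj(1) by (auto simp: insert_commute)
      have xy: "x \<noteq> y" "u \<noteq> y" using mem y by auto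
      have F': "\<not> (\<exists>U W. separated E x u U W \<and> U \<inter> W = {})"
        using False separated_sym[of E x u] by (metis Int_commute)
      have e1: "edge_separable ({e \<in> E. e \<subseteq> U} \<union> {{u, x}, {x, y}})"
        by (rule edge_separable_shortcut[OF es card2 sep y separated_connected[OF sep False card2 y] adj(1)])
      have e2: "edge_separable ({e \<in> E. e \<subseteq> W} \<union> {{x, u}, {u, y}})"
        by (rule edge_separable_shortcut[OF es card2 separated_sym[OF sep] y'
            separated_connected[OF separated_sym[OF sep] F' card2 y'] xu])
      \<comment> \<open>An end of degree at least 3 leaves at least two edges on its own side. As
        the deleted edge is counted too, replacing a side by a path of two edges, one of them the
        old edge, lowers the number of edges.\<close>
      have cE: "card E = Suc (card {e \<in> E. e \<subseteq> U} + card {e \<in> E. e \<subseteq> W})"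
        "2 \<le> card {e \<in> E. e \<subseteq> U}"
        using separated_card[OF fin sep adj(1) card2] adj(3) by auto
      have cW: "2 \<le> card {e \<in> E. e \<subseteq> W}"
        using separated_card(2)[OF fin separated_sym[OF sep] xu card2] adj(4) by auto
      have I1: "\<exists>c. contracted_colouring ({e \<in> E. e \<subseteq> U} \<union> {{u, x}, {x, y}}) M' c" if "matching M'" for M'
      proof (rule IH[OF _ _ _ e1 that])
        have "card ({e \<in> E. e \<subseteq> U} \<union> {{u, x}, {x, y}}) \<le> card {e \<in> E. e \<subseteq> U} + card {{u, x}, {x, y}}"
          by (rule card_Un_le)
        also have "card {{u, x}, {x, y}} \<le> 2" by (simp add: card_insert_if)
        finally show "card ({e \<in> E. e \<subseteq> U} \<union> {{u, x}, {x, y}}) < card E" using cE cW by simp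
      qed (use fin card2 xy mem in auto)
      have I2: "\<exists>c. contracted_colouring ({e \<in> E. e \<subseteq> W} \<union> {{x, u}, {u, y}}) M' c" if "matching M'" for M'
      proof (rule IH[OF _ _ _ e2 that])
        have "card ({e \<in> E. e \<subseteq> W} \<union> {{x, u}, {u, y}}) \<le> card {e \<in> E. e \<subseteq> W} + card {{x, u}, {u, y}}"
          by (rule card_Un_le)
        also have "card {{x, u}, {u, y}} \<le> 2" by (simp add: card_insert_if)
        finally show "card ({e \<in> E. e \<subseteq> W} \<union> {{x, u}, {u, y}}) < card E" using cE cW by simp
      qed (use fin card2 xy mem in auto)
      note strict = separated_sides[OF sep adj(1)]
      show ?thesis
      proof (cases "{u, x} \<in> M")
        case True
        show ?thesis by (rule contracted_colouring_matched_cut[OF sep y M True I1 I2])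
      next
        case nM: False
        show ?thesis
        proof (cases "\<forall>m\<in>M. m \<subseteq> W \<longrightarrow> y \<notin> m")
          case True
          from sub[OF strict(1) M] obtain c where "contracted_colouring {e \<in> E. e \<subseteq> U} M c" by blast
          then show ?thesis by (rule contracted_colouring_unmatched_cut[OF sep y M nM True _ I2])
        next
          case False
          then obtain n where n: "n \<in> M" "n \<subseteq> W" "y \<in> n" by blast
          \<comment> \<open>\<open>y\<close> is matched within at most one side: members of
            \<open>M\<close> at \<open>y\<close> in both sides would coincide and lie in the
            overlap, which is only \<open>y\<close>. So the roles of the sides can be
            exchanged.\<close>
          have yU: "\<forall>m\<in>M. m \<subseteq> U \<longrightarrow> y \<notin> m"
          proof (intro ballI impI notI)
            fix m assume m: "m \<in> M" "m \<subseteq> U" "y \<in> m"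
            have "m = n" by (rule matching_unique[OF M m(1) n(1) m(3) n(3)])
            then have "m \<subseteq> {y}" using m(2) n(2) y by auto
            then have "card m \<le> 1" using card_mono[of "{y}" m] by simp
            then show False using card2 ME m(1) by auto
          qed
          have nM': "{x, u} \<notin> M" using nM by (simp add: insert_commute)
          from sub[OF strict(2) M] obtain c where "contracted_colouring {e \<in> E. e \<subseteq> W} M c" by blast
          then show ?thesis
            by (rule contracted_colouring_unmatched_cut[OF separated_sym[OF sep] y' M nM' yU _ I1])
        qed
      qed
    qed
  qed
qed

section \<open>Edge colouring\<close>

text \<open>Says that the graph spanned by the edges is connected without cut vertices, phrased by
  splittings of the edge set so that it can be played off directly against the sides of
  separations.\<close>

definition inseparable :: "'a set set \<Rightarrow> bool" where
  "inseparable E \<longleftrightarrow> (\<forall>U W. (\<forall>e\<in>E. e \<subseteq> U \<or> e \<subseteq> W) \<longrightarrow> (\<forall>p\<in>U \<inter> W. \<forall>q\<in>U \<inter> W. p = q) \<longrightarrow>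
     (\<forall>e\<in>E. e \<subseteq> U) \<or> (\<forall>e\<in>E. e \<subseteq> W))"

lemma inseparableD:
  assumes "inseparable E" "\<And>e. e \<in> E \<Longrightarrow> e \<subseteq> U \<or> e \<subseteq> W"
    and "\<And>p. p \<in> U \<Longrightarrow> p \<in> W \<Longrightarrow> p = y"
  shows "(\<forall>e\<in>E. e \<subseteq> U) \<or> (\<forall>e\<in>E. e \<subseteq> W)"
proof -
  have "p = q" if "p \<in> U \<inter> W" "q \<in> U \<inter> W" for p q
    using assms(3)[of p] assms(3)[of q] that by simp
  then have "\<forall>p\<in>U \<inter> W. \<forall>q\<in>U \<inter> W. p = q" by (intro ballI)
  moreover have "\<forall>e\<in>E. e \<subseteq> U \<or> e \<subseteq> W" using assms(2) by (rule ballI)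
  ultimately show ?thesis
    using assms(1)[unfolded inseparable_def, THEN spec[of _ U], THEN spec[of _ W]] by (elim impE)
qed

text \<open>Submodularity of separations: the part \<open>P \<inter> U\<close> cut out by both is again a side of one.\<close>

lemma separated_uncross:
  assumes ins: "inseparable E" and UW: "separated E u x U W" and PQ: "separated E u' u P Q"
    and E: "{u, x} \<in> E" "{u, u'} \<in> E" "{u, t} \<in> E" and ne: "u' \<noteq> x" "t \<noteq> x" "t \<noteq> u'" "t \<noteq> u"
  shows "separated E u' u (P \<inter> U) (Q \<union> W)"
proof -
  note m1 = separated_mem[OF UW] and m2 = separated_mem[OF PQ]
  have u'U: "u' \<in> U" using separated_edge[OF UW E(2)] m1 ne by (auto simp: doubleton_eq_iff)
  have xQ: "x \<in> Q" using separated_edge[OF PQ E(1)] m2 m1 ne by (auto simp: doubleton_eq_iff)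
  have e4: "e = {u, x} \<or> e = {u, u'} \<or> (e \<subseteq> U \<or> e \<subseteq> W) \<and> (e \<subseteq> P \<or> e \<subseteq> Q)" if "e \<in> E" for e
    using separated_edge[OF UW that] separated_edge[OF PQ that] by (auto simp: insert_commute)
  \<comment> \<open>Otherwise \<open>W \<inter> Q\<close> with \<open>u\<close> added and
    \<open>U \<union> P\<close> would split the edges at the cut vertex \<open>u\<close>.\<close>
  have meet: "\<exists>r. r \<in> W \<and> r \<in> Q \<and> (r \<in> U \<or> r \<in> P)"
  proof (rule ccontr)
    assume no: "\<not> ?thesis"
    have "(\<forall>e\<in>E. e \<subseteq> insert u (W \<inter> Q)) \<or> (\<forall>e\<in>E. e \<subseteq> U \<union> P)"
    proof (rule inseparableD[OF ins])
      fix e assume "e \<in> E"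
      from e4[OF this] show "e \<subseteq> insert u (W \<inter> Q) \<or> e \<subseteq> U \<union> P"
        using m1 xQ u'U by auto
    next
      fix p assume "p \<in> insert u (W \<inter> Q)" "p \<in> U \<union> P"
      then show "p = u" using no by blast
    qed
    then show False
    proof
      assume "\<forall>e\<in>E. e \<subseteq> insert u (W \<inter> Q)"
      with E(2) have "u' \<in> insert u (W \<inter> Q)" by blast
      then show False using m2 by simp
    next
      assume "\<forall>e\<in>E. e \<subseteq> U \<union> P"
      with E(1) have "x \<in> U \<union> P" by blast
      then show False using no m1(3) xQ by blast
    qed
  qed
  \<comment> \<open>If \<open>u'\<close> were in \<open>W\<close>, it would be the only overlap of
    \<open>U\<close> and \<open>W\<close>, and \<open>U \<inter> Q\<close> would meet the rest only
    in \<open>u\<close>. The third neighbour \<open>t\<close> shows that this splitting at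
    \<open>u\<close> is not trivial.\<close>
  have u'W: "u' \<notin> W"
  proof
    assume u'W: "u' \<in> W"
    then have UWu': "r = u'" if "r \<in> U" "r \<in> W" for r
      using separated_overlap[OF UW that u'U] by blast
    obtain s where s: "s \<in> W" "s \<in> Q" "s \<in> P" using meet UWu' m2 by metis
    have no: "r \<notin> U" if "r \<in> P" "r \<in> Q" for r
      using separated_overlap[OF PQ that s(3,2)] UWu'[of s] s m2 by metis
    have t: "t \<in> U" "t \<in> Q"
      using separated_edge[OF UW E(3)] separated_edge[OF PQ E(3)] m1 m2 ne by (auto simp: doubleton_eq_iff)
    have "(\<forall>e\<in>E. e \<subseteq> U \<inter> Q) \<or> (\<forall>e\<in>E. e \<subseteq> insert u (W \<union> P))"
    proof (rule inseparableD[OF ins])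
      fix e assume "e \<in> E"
      from e4[OF this] show "e \<subseteq> U \<inter> Q \<or> e \<subseteq> insert u (W \<union> P)"
        using m1(3) u'W by auto
    next
      fix p assume p: "p \<in> U \<inter> Q" "p \<in> insert u (W \<union> P)"
      then show "p = u" using no[of p] UWu'[of p] m2 by auto
    qed
    then show False
    proof
      assume "\<forall>e\<in>E. e \<subseteq> U \<inter> Q"
      with E(1) have "x \<in> U" by blast
      then show False using m1 by simp
    next
      assume "\<forall>e\<in>E. e \<subseteq> insert u (W \<union> P)"
      with E(3) have "t \<in> insert u (W \<union> P)" by blast
      then show False using UWu'[of t] no[of t] t ne by auto
    qed
  qed
  show ?thesis
  proof (rule separatedI)
    fix e assume "e \<in> E"
    from e4[OF this] show "e = {u', u} \<or> e \<subseteq> P \<inter> U \<or> e \<subseteq> Q \<union> W"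
      using m1(3) m2(3) by (auto simp: insert_commute)
  next
    \<comment> \<open>The vertex \<open>r\<close> found in \<open>W \<inter> Q\<close> coincides
      with the overlap vertex of one separation and thereby identifies it with that of the
      other.\<close>
    have mixed: "p = q" if p: "p \<in> P" "p \<in> U" "p \<in> Q" and q: "q \<in> P" "q \<in> U" "q \<in> W" for p q
    proof -
      obtain r where r: "r \<in> W" "r \<in> Q" "r \<in> U \<or> r \<in> P" using meet by blast
      from r(3) show ?thesis
      proof
        assume "r \<in> U"
        then have "r = q" by (rule separated_overlap[OF UW]) (use r q in auto)
        then show ?thesis using separated_overlap[OF PQ p(1,3) q(1)] r(2) by blast
      next
        assume "r \<in> P"
        then have "r = p" by (rule separated_overlap[OF PQ]) (use r p in auto)
        then show ?thesis using separated_overlap[OF UW p(2) _ q(2,3)] r(1) by blast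
      qed
    qed
    fix p q assume "p \<in> P \<inter> U" "p \<in> Q \<union> W" "q \<in> P \<inter> U" "q \<in> Q \<union> W"
    then show "p = q"
      using mixed[of p q] mixed[of q p] separated_overlap[OF PQ, of p q] separated_overlap[OF UW, of p q]
      by auto
  qed (use m1 m2 u'U u'W in auto)
qed

text \<open>Extremal choice: among all separated edges with two ends of degree at least 3, the side
  of \<open>u\<close> is taken as small as possible. A second such neighbour \<open>p\<close> would,
  by uncrossing, give the side \<open>P \<inter> U\<close> for the edge from \<open>p\<close> to
  \<open>u\<close>, which is smaller because it lacks \<open>u\<close>.\<close>

lemma vertex_with_one_large_neighbour:
  assumes fin: "finite E" and card2: "\<forall>e\<in>E. card e = 2" and es: "edge_separable E"
    and ins: "inseparable E" and v: "3 \<le> vertex_degree E v"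
  shows "\<exists>u. 3 \<le> vertex_degree E u \<and>
    (\<exists>x. \<forall>p. {u, p} \<in> E \<longrightarrow> 3 \<le> vertex_degree E p \<longrightarrow> p = x)"
proof (cases "\<exists>u x. {u, x} \<in> E \<and> 3 \<le> vertex_degree E u \<and> 3 \<le> vertex_degree E x")
  case False
  with v show ?thesis by blast
next
  case True
  let ?S = "\<lambda>(u, x, U, W). separated E u x U W \<and> {u, x} \<in> E \<and> 3 \<le> vertex_degree E u \<and> 3 \<le> vertex_degree E x"
  \<comment> \<open>Sides may contain elements that are on no edge, even infinitely many; only
    vertices on edges are counted.\<close>
  let ?f = "\<lambda>(u, x, U, W). card (U \<inter> \<Union>E)"
  have finV: "finite (\<Union>E)"
    using fin card2 by (intro finite_Union) (auto intro: card_ge_0_finite)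
  have loop: "a \<noteq> b" if "{a, b} \<in> E" for a b using card2 that by fastforce
  obtain u x where ux: "{u, x} \<in> E" "3 \<le> vertex_degree E u" "3 \<le> vertex_degree E x" using True by blast
  moreover obtain U W where "separated E u x U W"
    using es ux(1) loop unfolding edge_separable_def by blast
  ultimately have "?S (u, x, U, W)" by simp
  from ex_has_least_nat[of ?S, OF this, of ?f]
  obtain z where z: "?S z" "\<And>z'. ?S z' \<Longrightarrow> ?f z \<le> ?f z'" by blast
  obtain u x U W where z': "z = (u, x, U, W)" by (cases z) auto
  have S: "separated E u x U W" "{u, x} \<in> E" "3 \<le> vertex_degree E u" "3 \<le> vertex_degree E x"
    using z(1) z' by auto
  have min: "card (U \<inter> \<Union>E) \<le> card (P \<inter> \<Union>E)"
    if "separated E a b P Q" "{a, b} \<in> E" "3 \<le> vertex_degree E a" "3 \<le> vertex_degree E b" for a b P Q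
    using z(2)[of "(a, b, P, Q)"] that z' by simp
  have "p = x" if p: "{u, p} \<in> E" "3 \<le> vertex_degree E p" for p
  proof (rule ccontr)
    assume px: "p \<noteq> x"
    have pu: "{p, u} \<in> E" using p(1) by (simp add: insert_commute)
    obtain P Q where PQ: "separated E p u P Q"
      using es pu loop unfolding edge_separable_def by blast
    have "\<not> {e \<in> E. u \<in> e} \<subseteq> {{u, x}, {u, p}}"
    proof
      assume "{e \<in> E. u \<in> e} \<subseteq> {{u, x}, {u, p}}"
      then have "vertex_degree E u \<le> card {{u, x}, {u, p}}"
        unfolding vertex_degree_def by (intro card_mono) auto
      also have "\<dots> \<le> 2" by (simp add: card_insert_if)
      finally show False using S(3) by simp
    qed
    then obtain e where e: "e \<in> E" "u \<in> e" "e \<noteq> {u, x}" "e \<noteq> {u, p}" by blast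
    then obtain t where t: "e = {u, t}" "t \<noteq> u" using card2 by (metis card_2_iff doubleton_eq_iff insertE singletonD)
    have sep: "separated E p u (P \<inter> U) (Q \<union> W)"
      by (rule separated_uncross[OF ins S(1) PQ S(2) p(1), of t]) (use e t px in auto)
    have "u \<in> U \<inter> \<Union>E" "u \<notin> P" using separated_mem[OF S(1)] separated_mem[OF PQ] S(2) by auto
    then have "P \<inter> U \<inter> \<Union>E \<subset> U \<inter> \<Union>E" by blast
    then have "card (P \<inter> U \<inter> \<Union>E) < card (U \<inter> \<Union>E)" using finV by (intro psubset_card_mono) auto
    moreover have "card (U \<inter> \<Union>E) \<le> card (P \<inter> U \<inter> \<Union>E)" by (rule min[OF sep pu p(2) S(3)])
    ultimately show False by simp
  qed
  with S(3) show ?thesis by blast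
qed

text \<open>The vertices \<open>v\<^sub>1\<close> and \<open>v\<^sub>2\<close> of degree 2 are merged, \<open>v\<^sub>1\<close> serving as the merged vertex. The
  path from \<open>v\<^sub>1\<close> through \<open>u\<close> and \<open>v\<^sub>2\<close> to \<open>w\<^sub>2\<close> in \<open>E\<close> plays the role of the new edge.\<close>

lemma edge_separable_merge:
  assumes es: "edge_separable E"
    and E: "{u, v\<^sub>1} \<in> E" "{u, v\<^sub>2} \<in> E" "{v\<^sub>1, w\<^sub>1} \<in> E" "{v\<^sub>2, w\<^sub>2} \<in> E"
    and E': "E' \<subseteq> E - {{u, v\<^sub>1}, {u, v\<^sub>2}, {v\<^sub>2, w\<^sub>2}}"
    and v1: "\<And>e. e \<in> E' \<Longrightarrow> v\<^sub>1 \<in> e \<Longrightarrow> e = {v\<^sub>1, w\<^sub>1}" and v2: "\<And>e. e \<in> E' \<Longrightarrow> v\<^sub>2 \<notin> e"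
    and u: "\<And>e f. e \<in> E' \<Longrightarrow> f \<in> E' \<Longrightarrow> u \<in> e \<Longrightarrow> u \<in> f \<Longrightarrow> e = f"
    and ne: "v\<^sub>1 \<noteq> v\<^sub>2" "w\<^sub>1 \<noteq> w\<^sub>2" "u \<noteq> v\<^sub>1" "u \<noteq> w\<^sub>2" "v\<^sub>1 \<noteq> w\<^sub>2" "v\<^sub>1 \<noteq> w\<^sub>1" "v\<^sub>2 \<noteq> w\<^sub>2"
  shows "edge_separable (insert {v\<^sub>1, w\<^sub>2} E')"
proof -
  let ?E = "insert {v\<^sub>1, w\<^sub>2} E'"
  \<comment> \<open>Disjoint sides have a spare overlap vertex, which is spent on the new edge:
    \<open>v\<^sub>1\<close> joins \<open>Q\<close>, unless it is the end \<open>a\<close>, in which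
    case \<open>w\<^sub>2\<close> joins \<open>P\<close>.\<close>
  have finish: "\<exists>P Q. separated ?E a b P Q"
    if PQ: "P \<inter> Q = {}" "a \<in> P" "b \<in> Q" "v\<^sub>1 \<in> P" "w\<^sub>2 \<in> Q" and ab: "{a, b} \<in> E'"
      and ed: "\<And>e. e \<in> E' \<Longrightarrow> e = {a, b} \<or> e \<subseteq> P \<or> e \<subseteq> Q" for a b P Q
  proof (cases "a = v\<^sub>1")
    case True
    then have "{a, b} = {v\<^sub>1, w\<^sub>1}" using v1 ab by blast
    with True ne have b: "b = w\<^sub>1" by (auto simp: doubleton_eq_iff)
    have "separated ?E a b (insert w\<^sub>2 P) Q"
      by (rule separatedI) (use PQ ed True b ne in blast)+
    then show ?thesis by (intro exI)
  next
    case False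
    have "separated ?E a b P (insert v\<^sub>1 Q)"
      by (rule separatedI) (use PQ ed False in blast)+
    then show ?thesis by (intro exI)
  qed
  have cross: "\<exists>P Q. separated ?E a b P Q"
    if sep: "separated E a b P Q" and ab: "{a, b} \<in> E'" and v: "v\<^sub>1 \<in> P" "v\<^sub>1 \<notin> Q" "w\<^sub>2 \<in> Q" "w\<^sub>2 \<notin> P"
    for a b P Q
  proof -
    note m = separated_mem[OF sep]
    have ed: "e = {a, b} \<or> e \<subseteq> P \<or> e \<subseteq> Q" if "e \<in> E'" for e
      using separated_edge[OF sep, of e] E' that by blast
    have nab: "{u, v\<^sub>1} \<noteq> {a, b}" "{u, v\<^sub>2} \<noteq> {a, b}" "{v\<^sub>2, w\<^sub>2} \<noteq> {a, b}" using E' ab by auto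
    have uP: "u \<in> P" using separated_edge[OF sep E(1)] nab v by auto
    have vQ: "v\<^sub>2 \<in> Q" using separated_edge[OF sep E(4)] nab v by auto
    have "v\<^sub>2 \<in> P \<or> u \<in> Q" using separated_edge[OF sep E(2)] nab by auto
    then show ?thesis
    proof
      assume vP: "v\<^sub>2 \<in> P"
      have ab2: "a \<noteq> v\<^sub>2" "b \<noteq> v\<^sub>2" using v2[OF ab] by auto
      show ?thesis
      proof (rule finish[of "P - {v\<^sub>2}" "Q - {v\<^sub>2}", OF _ _ _ _ _ ab])
        show "(P - {v\<^sub>2}) \<inter> (Q - {v\<^sub>2}) = {}" using separated_overlap[OF sep _ _ vP vQ] by blast
        show "e = {a, b} \<or> e \<subseteq> P - {v\<^sub>2} \<or> e \<subseteq> Q - {v\<^sub>2}" if "e \<in> E'" for e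
          using ed[OF that] v2[OF that] by auto
      qed (use m ab2 v ne in auto)
    next
      assume uQ: "u \<in> Q"
      have ov: "p = u" if "p \<in> P" "p \<in> Q" for p using separated_overlap[OF sep that uP uQ] .
      show ?thesis
      proof (cases "\<exists>e\<in>E'. u \<in> e \<and> e \<subseteq> P")
        case True
        then have uP: "e \<subseteq> P" if "e \<in> E'" "u \<in> e" for e using u that by blast
        show ?thesis
        proof (rule finish[of P "Q - {u}", OF _ _ _ _ _ ab])
          show "P \<inter> (Q - {u}) = {}" using ov by blast
          show "e = {a, b} \<or> e \<subseteq> P \<or> e \<subseteq> Q - {u}" if "e \<in> E'" for e
            using ed[OF that] uP[OF that] by blast
        qed (use m v ne uP uQ \<open>u \<in> P\<close> in auto)
      next
        case False
        show ?thesis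
        proof (rule finish[of "P - {u}" Q, OF _ _ _ _ _ ab])
          show "(P - {u}) \<inter> Q = {}" using ov by blast
          show "e = {a, b} \<or> e \<subseteq> P - {u} \<or> e \<subseteq> Q" if "e \<in> E'" for e
            using ed[OF that] False that by blast
        qed (use m v ne uP uQ in auto)
      qed
    qed
  qed
  have old: "\<exists>P Q. separated ?E a b P Q" if ab: "{a, b} \<in> E'" "a \<noteq> b" for a b
  proof -
    have "{a, b} \<in> E" using ab(1) E' by blast
    then obtain P Q where sep: "separated E a b P Q"
      using es ab(2) unfolding edge_separable_def by blast
    have nab: "{u, v\<^sub>1} \<noteq> {a, b}" "{v\<^sub>2, w\<^sub>2} \<noteq> {a, b}" using E' ab by auto
    have "v\<^sub>1 \<in> P \<or> v\<^sub>1 \<in> Q" "w\<^sub>2 \<in> P \<or> w\<^sub>2 \<in> Q"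
      using separated_edge[OF sep E(1)] separated_edge[OF sep E(4)] nab by auto
    then consider "{v\<^sub>1, w\<^sub>2} \<subseteq> P \<or> {v\<^sub>1, w\<^sub>2} \<subseteq> Q" | "v\<^sub>1 \<in> P" "v\<^sub>1 \<notin> Q" "w\<^sub>2 \<in> Q" "w\<^sub>2 \<notin> P"
      | "v\<^sub>1 \<in> Q" "v\<^sub>1 \<notin> P" "w\<^sub>2 \<in> P" "w\<^sub>2 \<notin> Q" by blast
    then show ?thesis
    proof cases
      case 1
      have "e = {a, b} \<or> e \<subseteq> P \<or> e \<subseteq> Q" if "e \<in> ?E" for e
        using that 1 separated_edge[OF sep, of e] E' by blast
      then have "separated ?E a b P Q"
        using separated_mem[OF sep] separated_overlap[OF sep] by (intro separatedI)
      then show ?thesis by (intro exI)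
    next
      case 2
      then show ?thesis by (rule cross[OF sep ab(1)])
    next
      case 3
      have "{b, a} \<in> E'" using ab(1) by (simp add: insert_commute)
      from cross[OF separated_sym[OF sep] this 3] obtain P Q where "separated ?E b a P Q" by blast
      from separated_sym[OF this] show ?thesis by (intro exI)
    qed
  qed
  \<comment> \<open>In the new graph \<open>v\<^sub>1\<close> has only the neighbours
    \<open>w\<^sub>1\<close> and \<open>w\<^sub>2\<close>, so \<open>w\<^sub>1\<close> separates the
    ends of the new edge.\<close>
  have new: "separated ?E v\<^sub>1 w\<^sub>2 {v\<^sub>1, w\<^sub>1} (- {v\<^sub>1})"
    by (rule separatedI) (use v1 ne in blast)+
  show ?thesis
    unfolding edge_separable_def
  proof (intro allI impI)
    fix a b assume ab: "{a, b} \<in> ?E" "a \<noteq> b"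
    show "\<exists>P Q. separated ?E a b P Q"
    proof (cases "{a, b} \<in> E'")
      case True
      then show ?thesis using ab(2) by (rule old)
    next
      case False
      then have "a = v\<^sub>1 \<and> b = w\<^sub>2 \<or> a = w\<^sub>2 \<and> b = v\<^sub>1" using ab(1) by (auto simp: doubleton_eq_iff)
      then show ?thesis
        by (elim disjE conjE; hypsubst) (rule exI, rule exI, rule new separated_sym[OF new])+
    qed
  qed
qed

section \<open>Extending and gluing proper edge colourings\<close>

definition proper_edge_colouring :: "'a set set \<Rightarrow> nat \<Rightarrow> ('a set \<Rightarrow> nat) \<Rightarrow> bool" where
  "proper_edge_colouring E k l \<longleftrightarrow> (\<forall>e\<in>E. l e < k) \<and>
     (\<forall>e\<in>E. \<forall>f\<in>E. e \<noteq> f \<longrightarrow> e \<inter> f \<noteq> {} \<longrightarrow> l e \<noteq> l f)"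

lemma proper_edge_colouring_insert:
  assumes l: "proper_edge_colouring (E - {e}) k l" and fin: "finite E"
    and few: "card {f \<in> E - {e}. f \<inter> e \<noteq> {}} < k"
  shows "\<exists>l. proper_edge_colouring E k l"
proof -
  let ?N = "{f \<in> E - {e}. f \<inter> e \<noteq> {}}"
  have "card (l ` ?N) < card {..<k}" using card_image_le[of ?N l] few fin by simp
  moreover have "finite (l ` ?N)" using fin by simp
  ultimately have "\<not> {..<k} \<subseteq> l ` ?N" using card_mono[of "l ` ?N" "{..<k}"] by linarith
  then obtain t where t: "t < k" "t \<notin> l ` ?N" by blast
  have "l f \<noteq> t" if "f \<in> E" "f \<noteq> e" "f \<inter> e \<noteq> {}" for f using t(2) that by blast
  then have "proper_edge_colouring E k (l(e := t))"
    using l t(1) unfolding proper_edge_colouring_def by (auto simp: Int_commute)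
  then show ?thesis by blast
qed

lemma edge_degree_neighbours:
  assumes "finite E" "{u, v} \<in> E" "vertex_degree E u + vertex_degree E v \<le> Suc k"
  shows "card {f \<in> E - {{u, v}}. f \<inter> {u, v} \<noteq> {}} < k"
proof -
  have *: "Suc (card {f \<in> E - {{u, v}}. w \<in> f}) = vertex_degree E w" if "w \<in> {u, v}" for w
  proof -
    have "{f \<in> E. w \<in> f} = insert {u, v} {f \<in> E - {{u, v}}. w \<in> f}" using assms(2) that by auto
    then show ?thesis unfolding vertex_degree_def using assms(1) by simp
  qed
  have "{f \<in> E - {{u, v}}. f \<inter> {u, v} \<noteq> {}} = {f \<in> E - {{u, v}}. u \<in> f} \<union> {f \<in> E - {{u, v}}. v \<in> f}"
    by auto
  then have "card {f \<in> E - {{u, v}}. f \<inter> {u, v} \<noteq> {}} \<le>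
      card {f \<in> E - {{u, v}}. u \<in> f} + card {f \<in> E - {{u, v}}. v \<in> f}"
    by (metis (no_types, lifting) card_Un_le)
  then show ?thesis using assms(3) *[of u] *[of v] by simp
qed

text \<open>The size bound leaves room outside \<open>T\<close> for a set as large as
  \<open>S\<close>; a bijection onto it and one between the complements make up the
  permutation.\<close>

lemma permute_away:
  assumes "S \<subseteq> {..<k}" "T \<subseteq> {..<k}" "card S + card T \<le> (k::nat)"
  shows "\<exists>\<pi>. inj_on \<pi> {..<k} \<and> \<pi> ` {..<k} \<subseteq> {..<k} \<and> \<pi> ` S \<inter> T = {}"
proof -
  have fin: "finite S" "finite T" using assms finite_subset by blast+
  have "card S \<le> card ({..<k} - T)" using assms fin by (simp add: card_Diff_subset)
  then obtain S' where S': "S' \<subseteq> {..<k} - T" "card S' = card S" by (meson obtain_subset_with_card_n)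
  have "finite S'" using S'(1) finite_subset by blast
  then obtain f where f: "bij_betw f S S'" using finite_same_card_bij fin S'(2) by metis
  have "S' \<subseteq> {..<k}" using S'(1) by blast
  then have "card ({..<k} - S) = card ({..<k} - S')"
    using assms(1) S'(2) fin(1) \<open>finite S'\<close> by (simp add: card_Diff_subset)
  then obtain g where g: "bij_betw g ({..<k} - S) ({..<k} - S')"
    using finite_same_card_bij[of "{..<k} - S" "{..<k} - S'"] by auto
  have "bij_betw (\<lambda>z. if z \<in> S then f z else g z) (S \<union> ({..<k} - S)) (S' \<union> ({..<k} - S'))"
    using f g by (intro bij_betw_disjoint_Un) auto
  moreover have "S \<union> ({..<k} - S) = {..<k}" "S' \<union> ({..<k} - S') = {..<k}" using assms(1) S'(1) by auto
  moreover have "(\<lambda>z. if z \<in> S then f z else g z) ` S = S'" using f by (simp add: bij_betw_def)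
  ultimately have "bij_betw (\<lambda>z. if z \<in> S then f z else g z) {..<k} {..<k} \<and>
      (\<lambda>z. if z \<in> S then f z else g z) ` S \<inter> T = {}" using S'(1) by auto
  then show ?thesis
    unfolding bij_betw_def
    by (elim conjE, intro exI conjI) (assumption, rule equalityD1, assumption, assumption)
qed

text \<open>Conflicts between the sides occur only at \<open>y\<close>. Its edges number at most
  \<open>k\<close>, so the colours that one side uses there can be permuted away from those of the
  other.\<close>

lemma proper_edge_colouring_glue:
  assumes fin: "finite E" and E: "\<And>e. e \<in> E \<Longrightarrow> e \<subseteq> U \<or> e \<subseteq> W" and y: "\<And>p. p \<in> U \<Longrightarrow> p \<in> W \<Longrightarrow> p = y"
    and card2: "\<forall>e\<in>E. card e = 2" and deg: "vertex_degree E y \<le> k"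
    and l1: "proper_edge_colouring {e \<in> E. e \<subseteq> U} k l\<^sub>1"
    and l2: "proper_edge_colouring {e \<in> E. e \<subseteq> W} k l\<^sub>2"
  shows "\<exists>l. proper_edge_colouring E k l"
proof -
  let ?Y1 = "{e \<in> E. e \<subseteq> U \<and> y \<in> e}" and ?Y2 = "{e \<in> E. e \<subseteq> W \<and> y \<in> e}"
  have disj: "\<not> e \<subseteq> W" if "e \<in> E" "e \<subseteq> U" for e
  proof
    assume "e \<subseteq> W"
    then have "e \<subseteq> {y}" using that(2) y by blast
    then have "card e \<le> 1" using card_mono[of "{y}" e] by simp
    then show False using card2 that(1) by auto
  qed
  have "card ?Y1 + card ?Y2 = card (?Y1 \<union> ?Y2)"
    using fin disj by (intro card_Un_disjoint[symmetric]) auto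
  also have "\<dots> \<le> vertex_degree E y"
    unfolding vertex_degree_def using fin by (intro card_mono) auto
  finally have "card ?Y1 + card ?Y2 \<le> k" using deg by simp
  moreover have "card (l\<^sub>1 ` ?Y1) \<le> card ?Y1" "card (l\<^sub>2 ` ?Y2) \<le> card ?Y2"
    using fin by (auto intro: card_image_le)
  ultimately have le: "card (l\<^sub>2 ` ?Y2) + card (l\<^sub>1 ` ?Y1) \<le> k" by linarith
  have "l\<^sub>2 ` ?Y2 \<subseteq> {..<k}" "l\<^sub>1 ` ?Y1 \<subseteq> {..<k}"
    using l1 l2 by (auto simp: proper_edge_colouring_def)
  from permute_away[OF this le] obtain \<pi> where \<pi>: "inj_on \<pi> {..<k}" "\<pi> ` {..<k} \<subseteq> {..<k}" "\<pi> ` (l\<^sub>2 ` ?Y2) \<inter> l\<^sub>1 ` ?Y1 = {}"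
    by blast
  let ?l = "\<lambda>e. if e \<subseteq> U then l\<^sub>1 e else \<pi> (l\<^sub>2 e)"
  have W: "e \<subseteq> W" if "e \<in> E" "\<not> e \<subseteq> U" for e using E that by blast
  have lt: "?l e < k" if "e \<in> E" for e
  proof (cases "e \<subseteq> U")
    case True
    then show ?thesis using l1 that by (simp add: proper_edge_colouring_def)
  next
    case False
    then have "l\<^sub>2 e \<in> {..<k}" using l2 that W by (simp add: proper_edge_colouring_def)
    then have "\<pi> (l\<^sub>2 e) \<in> {..<k}" using \<pi>(2) by blast
    then show ?thesis using False by simp
  qed
  have mixed: "l\<^sub>1 e \<noteq> \<pi> (l\<^sub>2 f)" if ef: "e \<in> E" "e \<subseteq> U" "f \<in> E" "f \<subseteq> W" "e \<inter> f \<noteq> {}" for e f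
  proof -
    obtain p where "p \<in> e" "p \<in> f" using ef(5) by blast
    moreover from this have "p = y" using y ef(2,4) by blast
    ultimately have "y \<in> e" "y \<in> f" by simp_all
    then have m: "l\<^sub>1 e \<in> l\<^sub>1 ` ?Y1" "\<pi> (l\<^sub>2 f) \<in> \<pi> ` (l\<^sub>2 ` ?Y2)" using ef by auto
    show ?thesis
    proof
      assume eq: "l\<^sub>1 e = \<pi> (l\<^sub>2 f)"
      have "l\<^sub>1 e \<in> \<pi> ` (l\<^sub>2 ` ?Y2) \<inter> l\<^sub>1 ` ?Y1" by (rule IntI[OF m(2)[folded eq] m(1)])
      then show False unfolding \<pi>(3) by (rule emptyE)
    qed
  qed
  have "?l e \<noteq> ?l f" if ef: "e \<in> E" "f \<in> E" "e \<noteq> f" "e \<inter> f \<noteq> {}" for e f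
  proof -
    consider "e \<subseteq> U" "f \<subseteq> U" | "e \<subseteq> U" "\<not> f \<subseteq> U" | "\<not> e \<subseteq> U" "f \<subseteq> U" | "\<not> e \<subseteq> U" "\<not> f \<subseteq> U" by blast
    then show ?thesis
    proof cases
      case 1
      then show ?thesis using l1 ef by (simp add: proper_edge_colouring_def)
    next
      case 2
      then show ?thesis using mixed[of e f] W[of f] ef by simp
    next
      case 3
      then show ?thesis using mixed[of f e] W[of e] ef by (simp add: Int_commute eq_commute)
    next
      case 4
      then have "l\<^sub>2 e \<noteq> l\<^sub>2 f" "l\<^sub>2 e < k" "l\<^sub>2 f < k"
        using l2 ef W by (simp_all add: proper_edge_colouring_def)
      then show ?thesis using 4 \<pi>(1) by (simp add: inj_on_eq_iff)
    qed
  qed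
  with lt have "proper_edge_colouring E k ?l" by (simp add: proper_edge_colouring_def)
  then show ?thesis by blast
qed

text \<open>Values are chosen greedily, keeping \<open>i\<close> and \<open>j\<close> for the end.
  With as many values as indices, a common forbidden value could make the choice impossible; the two
  different ones at \<open>i\<close> and \<open>j\<close> prevent this.\<close>

lemma distinct_representatives:
  assumes "finite J" "i \<notin> J" "j \<notin> J" "i \<noteq> j" "\<beta> i \<noteq> \<beta> j" "finite A" "card J + 2 \<le> card A"
  shows "\<exists>g. inj_on g (insert i (insert j J)) \<and> g ` insert i (insert j J) \<subseteq> A \<and>
    (\<forall>v\<in>insert i (insert j J). g v \<noteq> \<beta> v)"
  using assms
proof (induction J arbitrary: A rule: finite_induct)
  case empty
  then obtain a b where ab: "a \<in> A" "b \<in> A" "a \<noteq> b"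
    by (metis One_nat_def Suc_1 add_0 card.empty card_le_Suc0_iff_eq not_less_eq_eq)
  \<comment> \<open>If the two values are wrong in one order, they are right in the other, since
    \<open>\<beta> i\<close> and \<open>\<beta> j\<close> differ.\<close>
  obtain a b where ab: "a \<in> A" "b \<in> A" "a \<noteq> b" "a \<noteq> \<beta> i" "b \<noteq> \<beta> j"
    using ab empty.prems(4) by metis
  show ?case by (rule exI[of _ "\<lambda>v. if v = i then a else b"]) (use ab empty.prems(3) in auto)
next
  case (insert v J)
  have "\<not> A \<subseteq> {\<beta> v}" using insert.prems(6) insert.hyps card_mono[of "{\<beta> v}" A] by auto
  then obtain a where a: "a \<in> A" "a \<noteq> \<beta> v" by blast
  have "card J + 2 \<le> card (A - {a})" using insert.prems insert.hyps a(1) by simp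
  then obtain g where g: "inj_on g (insert i (insert j J))" "g ` insert i (insert j J) \<subseteq> A - {a}"
    "\<forall>v\<in>insert i (insert j J). g v \<noteq> \<beta> v"
    using insert.IH[of "A - {a}"] insert.prems by auto
  have v: "v \<notin> insert i (insert j J)" using insert.prems insert.hyps by auto
  have *: "insert i (insert j (insert v J)) = insert v (insert i (insert j J))" by auto
  have im: "(g(v := a)) ` insert v X = insert a (g ` X)" "inj_on (g(v := a)) X = inj_on g X"
    if "v \<notin> X" for X
    using that by (auto simp: inj_on_def)
  have "inj_on (g(v := a)) (insert v (insert i (insert j J)))"
    unfolding inj_on_insert[of _ v]
  proof
    show "inj_on (g(v := a)) (insert i (insert j J))" using im(2)[OF v] g(1) by simp
    have "(g(v := a)) ` (insert i (insert j J) - {v}) = g ` insert i (insert j J)"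
      using v by (intro image_cong) auto
    then show "(g(v := a)) v \<notin> (g(v := a)) ` (insert i (insert j J) - {v})" using g(2) by auto
  qed
  moreover have "(g(v := a)) ` insert v (insert i (insert j J)) \<subseteq> A"
    unfolding im(1)[OF v] using g(2) a(1) by blast
  moreover have "\<forall>z\<in>insert v (insert i (insert j J)). (g(v := a)) z \<noteq> \<beta> z"
    using g(3) a(2) v by simp
  ultimately show ?case unfolding * by blast
qed

lemma proper_edge_colouringD:
  "proper_edge_colouring E k l \<Longrightarrow> e \<in> E \<Longrightarrow> f \<in> E \<Longrightarrow> e \<noteq> f \<Longrightarrow> e \<inter> f \<noteq> {} \<Longrightarrow> l e \<noteq> l f"
  by (simp add: proper_edge_colouring_def)

text \<open>Undoes the merging: \<open>m\<close> is the original edge and \<open>n\<close> its image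
  in the merged graph.\<close>

lemma proper_edge_colouring_recolour:
  assumes l: "proper_edge_colouring (insert n (E - {m})) k l"
    and n: "\<And>e. e \<in> E - {m} \<Longrightarrow> e \<inter> m \<noteq> {} \<Longrightarrow> l n \<noteq> l e"
  shows "proper_edge_colouring E k (l(m := l n))"
  unfolding proper_edge_colouring_def
proof (intro conjI ballI impI)
  fix e assume "e \<in> E"
  then show "(l(m := l n)) e < k" using l by (simp add: proper_edge_colouring_def)
next
  fix e f assume ef: "e \<in> E" "f \<in> E" "e \<noteq> f" "e \<inter> f \<noteq> {}"
  then have fe: "f \<inter> e \<noteq> {}" by (simp add: Int_commute)
  consider "e = m" | "f = m" | "e \<noteq> m" "f \<noteq> m" by blast
  then show "(l(m := l n)) e \<noteq> (l(m := l n)) f"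
  proof cases
    case 1
    then show ?thesis using n[of f] ef fe by simp
  next
    case 2
    then show ?thesis using n[of e] ef by simp
  next
    case 3
    then have "l e \<noteq> l f" using proper_edge_colouringD[OF l, of e f] ef by simp
    then show ?thesis using 3 by simp
  qed
qed

text \<open>Away from \<open>u\<close>, the uncoloured edge to \<open>v\<close> meets only
  \<open>f v\<close>, so each member of \<open>N\<close> forbids one colour. The degree bound leaves
  at least as many free colours at \<open>u\<close> as there are members of \<open>N\<close>, and
  the unequal colours at \<open>v\<^sub>1\<close> and \<open>v\<^sub>2\<close> make a choice of
  distinct ones possible.\<close>

lemma proper_edge_colouring_add_star:
  assumes fin: "finite E" and card2: "\<forall>e\<in>E. card e = 2" and deg: "vertex_degree E u \<le> k"
    and uN: "\<And>v. v \<in> N \<Longrightarrow> {u, v} \<in> E" "\<And>v. v \<in> N \<Longrightarrow> u \<noteq> v"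
    and f: "\<And>v e. v \<in> N \<Longrightarrow> e \<in> E \<Longrightarrow> v \<in> e \<Longrightarrow> e = {u, v} \<or> e = f v"
    and l: "proper_edge_colouring (E - (\<lambda>v. {u, v}) ` N) k l"
    and v12: "v\<^sub>1 \<in> N" "v\<^sub>2 \<in> N" "v\<^sub>1 \<noteq> v\<^sub>2" "l (f v\<^sub>1) \<noteq> l (f v\<^sub>2)"
  shows "\<exists>l. proper_edge_colouring E k l"
proof -
  let ?S = "(\<lambda>v. {u, v}) ` N"
  let ?E = "E - ?S"
  have finN: "finite N"
    by (rule inj_on_finite[of "\<lambda>v. {u, v}" N E]) (use uN fin in \<open>auto simp: inj_on_def doubleton_eq_iff\<close>)
  have cS: "card ?S = card N" by (rule card_image) (auto simp: inj_on_def doubleton_eq_iff)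
  let ?L = "l ` {e \<in> ?E. u \<in> e}"
  let ?A = "{..<k} - ?L"
  have "{e \<in> E. u \<in> e} = {e \<in> ?E. u \<in> e} \<union> ?S" using uN(1) by auto
  moreover have "card ({e \<in> ?E. u \<in> e} \<union> ?S) = card {e \<in> ?E. u \<in> e} + card ?S"
    using fin finN by (intro card_Un_disjoint) auto
  ultimately have "card {e \<in> ?E. u \<in> e} + card N \<le> k"
    using deg cS unfolding vertex_degree_def by simp
  moreover have "card ?L \<le> card {e \<in> ?E. u \<in> e}" using fin by (intro card_image_le) auto
  moreover have "k - card ?L \<le> card ?A" using diff_card_le_card_Diff[of ?L "{..<k}"] fin by simp
  ultimately have NA: "card N \<le> card ?A" by linarith
  define J where "J = N - {v\<^sub>1, v\<^sub>2}"
  have N: "N = insert v\<^sub>1 (insert v\<^sub>2 J)" using v12(1,2) by (auto simp: J_def)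
  have J: "finite J" "v\<^sub>1 \<notin> J" "v\<^sub>2 \<notin> J" using finN by (auto simp: J_def)
  then have "card N = card J + 2" using N v12(3) by simp
  then have "card J + 2 \<le> card ?A" using NA by simp
  from distinct_representatives[where \<beta> = "\<lambda>v. l (f v)", OF J v12(3,4) _ this]
  have "\<exists>g. inj_on g N \<and> g ` N \<subseteq> ?A \<and> (\<forall>v\<in>N. g v \<noteq> l (f v))" unfolding N by simp
  then obtain g where g: "inj_on g N" "g ` N \<subseteq> ?A" "\<And>v. v \<in> N \<Longrightarrow> g v \<noteq> l (f v)" by blast
  define l' where "l' e = (if e \<in> ?E then l e else g (the_elem (e - {u})))" for e
  have l'N: "l' {u, v} = g v" if "v \<in> N" for v
  proof -
    have "{u, v} - {u} = {v}" using uN(2)[OF that] by auto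
    then show ?thesis using that by (simp add: l'_def)
  qed
  have mixed: "l' e \<noteq> l' {u, v}" if "e \<in> ?E" "v \<in> N" "e \<inter> {u, v} \<noteq> {}" for e v
  proof (cases "u \<in> e")
    case True
    then have "l e \<in> ?L" using that(1) by blast
    moreover have "g v \<in> ?A" using g(2) that(2) by blast
    ultimately show ?thesis using l'N[OF that(2)] that(1) by (auto simp: l'_def)
  next
    case False
    then have "v \<in> e" "e \<noteq> {u, v}" "e \<in> E" using that by auto
    then have "e = f v" using f that(2) by blast
    then show ?thesis using l'N[OF that(2)] that(1) g(3)[OF that(2)] by (simp add: l'_def)
  qed
  have split: "e \<in> ?E \<or> (\<exists>v\<in>N. e = {u, v})" if "e \<in> E" for e using that by blast
  have "l' e < k" if "e \<in> E" for e
    using split[OF that]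
  proof
    assume "e \<in> ?E"
    then show ?thesis using l by (simp add: l'_def proper_edge_colouring_def)
  next
    assume "\<exists>v\<in>N. e = {u, v}"
    then show ?thesis using l'N g(2) by auto
  qed
  moreover have "l' e \<noteq> l' e'" if e: "e \<in> E" "e' \<in> E" "e \<noteq> e'" "e \<inter> e' \<noteq> {}" for e e'
  proof -
    consider "e \<in> ?E" "e' \<in> ?E" | v where "e \<in> ?E" "v \<in> N" "e' = {u, v}"
      | v where "e' \<in> ?E" "v \<in> N" "e = {u, v}" | v v' where "v \<in> N" "v' \<in> N" "e = {u, v}" "e' = {u, v'}"
      using split[OF e(1)] split[OF e(2)] by blast
    then show ?thesis
    proof cases
      case 1
      then show ?thesis using l e by (simp add: l'_def proper_edge_colouring_def)
    next
      case 2
      then show ?thesis using mixed[of e v] e by simp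
    next
      case 3
      have "e' \<inter> e \<noteq> {}" using e(4) by (simp add: Int_commute)
      then show ?thesis using mixed[of e' v] 3 by (metis (full_types))
    next
      case 4
      then have "v \<noteq> v'" using e(3) by auto
      then show ?thesis using 4 l'N g(1) by (simp add: inj_on_eq_iff)
    qed
  qed
  ultimately have "proper_edge_colouring E k l'" by (simp add: proper_edge_colouring_def)
  then show ?thesis by blast
qed

text \<open>Induction on the number of edges. Edges of small degree sum and cut vertices are
  disposed of directly; what remains has so few vertices of small degree next to each other that the
  star at a well-chosen \<open>u\<close> can be removed and restored.\<close>

lemma proper_edge_colouring_exists:
  fixes E :: "'a set set"
  assumes "finite E" "\<forall>e\<in>E. card e = 2" "edge_separable E" "\<forall>v. vertex_degree E v \<le> k" "3 \<le> k"
  shows "\<exists>l. proper_edge_colouring E k l"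
  using assms(1-4)
proof (induction "card E" arbitrary: E rule: less_induct)
  case less
  note fin = less.prems(1) and card2 = less.prems(2) and es = less.prems(3) and deg = less.prems(4)
  have loop: "a \<noteq> b" if "{a, b} \<in> E" for a b using card2 that by fastforce
  have deg_mono: "vertex_degree E' v \<le> vertex_degree E v" if "E' \<subseteq> E" for E' v
    unfolding vertex_degree_def using fin that by (intro card_mono) auto
  have sub: "\<exists>l. proper_edge_colouring E' k l" if E': "E' \<subset> E" for E'
  proof (rule less.hyps)
    show "card E' < card E" using fin E' by (rule psubset_card_mono)
    show "finite E'" "edge_separable E'"
      using fin E' es by (auto intro: finite_subset edge_separable_subset)
    show "\<forall>e\<in>E'. card e = 2" using card2 E' by blast
    show "\<forall>v. vertex_degree E' v \<le> k" using deg deg_mono E' le_trans by blast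
  qed
  show ?case
  proof (cases "\<exists>u v. {u, v} \<in> E \<and> vertex_degree E u + vertex_degree E v \<le> Suc k")
    case True
    then obtain u v where uv: "{u, v} \<in> E" "vertex_degree E u + vertex_degree E v \<le> Suc k" by blast
    have "E - {{u, v}} \<subset> E" using uv(1) by blast
    from sub[OF this] obtain l where "proper_edge_colouring (E - {{u, v}}) k l" by blast
    then show ?thesis by (rule proper_edge_colouring_insert[OF _ fin edge_degree_neighbours[OF fin uv]])
  next
    case large: False
    show ?thesis
    proof (cases "inseparable E")
      case False
      then obtain U W where UW: "\<forall>e\<in>E. e \<subseteq> U \<or> e \<subseteq> W" "\<forall>p\<in>U \<inter> W. \<forall>q\<in>U \<inter> W. p = q"
        "\<not> (\<forall>e\<in>E. e \<subseteq> U)" "\<not> (\<forall>e\<in>E. e \<subseteq> W)" unfolding inseparable_def by blast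
      have "{e \<in> E. e \<subseteq> U} \<subset> E" using UW(3) by auto
      moreover have "{e \<in> E. e \<subseteq> W} \<subset> E" using UW(4) by auto
      ultimately obtain l\<^sub>1 l\<^sub>2 where l: "proper_edge_colouring {e \<in> E. e \<subseteq> U} k l\<^sub>1"
        "proper_edge_colouring {e \<in> E. e \<subseteq> W} k l\<^sub>2" using sub by metis
      obtain y where y: "\<And>p. p \<in> U \<Longrightarrow> p \<in> W \<Longrightarrow> p = y"
      proof (cases "U \<inter> W = {}")
        case True
        then show ?thesis using that by blast
      next
        case False
        then obtain y where "y \<in> U \<inter> W" by blast
        then show ?thesis using that[of y] UW(2) by (metis IntI)
      qed
      show ?thesis
        by (rule proper_edge_colouring_glue[OF fin _ y card2 _ l]) (use UW(1) deg in blast)+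
    next
      case ins: True
      show ?thesis
      proof (cases "E = {}")
        case True
        then have "proper_edge_colouring E k (\<lambda>_. 0)" by (simp add: proper_edge_colouring_def)
        then show ?thesis by blast
      next
        case False
        then obtain a b where ab: "{a, b} \<in> E" using card2 by (metis card_2_iff ex_in_conv)
        have bound: "Suc k < vertex_degree E p + vertex_degree E q" if "{p, q} \<in> E" for p q
          using large that by (meson not_less)
        \<comment> \<open>Ends of degree at most 2 would have degree sum at most 4, which
          \<open>3 \<le> k\<close> puts within the range already settled.\<close>
        have "3 \<le> vertex_degree E a \<or> 3 \<le> vertex_degree E b"
          using bound[OF ab] \<open>3 \<le> k\<close> by linarith
        then have "\<exists>v. 3 \<le> vertex_degree E v" by (elim disjE) (rule exI, assumption)+
        then obtain u x where u: "3 \<le> vertex_degree E u"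
          "\<And>p. {u, p} \<in> E \<Longrightarrow> 3 \<le> vertex_degree E p \<Longrightarrow> p = x"
          using vertex_with_one_large_neighbour[OF fin card2 es ins] by metis
        define N where "N = {v. {u, v} \<in> E \<and> vertex_degree E v < 3}"
        \<comment> \<open>As \<open>u\<close> has degree at most \<open>k\<close>,
          \<open>bound\<close> excludes degree 1 for \<open>v\<close>. So \<open>v\<close> has
          exactly one other neighbour, and \<open>bound\<close> applied to that edge makes this
          neighbour large.\<close>
        have ex_f: "\<exists>w. {v, w} \<in> E \<and> w \<noteq> u \<and> {e \<in> E. v \<in> e} = {{u, v}, {v, w}} \<and> 3 \<le> vertex_degree E w"
          if v: "v \<in> N" for v
        proof -
          have uv: "{u, v} \<in> E" "vertex_degree E v < 3" using v by (auto simp: N_def)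
          have "vertex_degree E u \<le> k" using deg by blast
          then have "vertex_degree E v = 2" using bound[OF uv(1)] uv(2) by linarith
          then obtain e e' where e: "{e \<in> E. v \<in> e} = {e, e'}" "e \<noteq> e'"
            unfolding vertex_degree_def by (metis (no_types, lifting) card_2_iff)
          have "{u, v} \<in> {e, e'}" using uv(1) unfolding e(1)[symmetric] by simp
          then obtain e'' where e'': "{e \<in> E. v \<in> e} = {{u, v}, e''}" "e'' \<noteq> {u, v}" using e by blast
          then have "e'' \<in> E" "v \<in> e''" by blast+
          moreover from this obtain w where w: "e'' = {v, w}" "w \<noteq> v"
            using card2 by (metis card_2_iff doubleton_eq_iff insertE singletonD)
          ultimately have vw: "{v, w} \<in> E" "w \<noteq> u" using e''(2) by (auto simp: insert_commute)
          have "3 \<le> vertex_degree E w" using bound[OF vw(1)] uv(2) \<open>3 \<le> k\<close> by linarith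
          then show ?thesis using vw e''(1) w(1) by blast
        qed
        then have "\<forall>v\<in>N. \<exists>w. {v, w} \<in> E \<and> w \<noteq> u \<and> {e \<in> E. v \<in> e} = {{u, v}, {v, w}} \<and>
            3 \<le> vertex_degree E w" by (rule ballI)
        from bchoice[OF this] obtain w where "\<forall>v\<in>N. {v, w v} \<in> E \<and> w v \<noteq> u \<and>
            {e \<in> E. v \<in> e} = {{u, v}, {v, w v}} \<and> 3 \<le> vertex_degree E (w v)" by (elim exE)
        note w = bspec[OF this]
        have wE: "{v, w v} \<in> E" "w v \<noteq> u" "3 \<le> vertex_degree E (w v)" "w v \<notin> N" "v \<noteq> w v" if "v \<in> N" for v
          using w[OF that] loop by (auto simp: N_def)
        have at: "e = {u, v} \<or> e = {v, w v}" if "v \<in> N" "e \<in> E" "v \<in> e" for e v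
          using w[OF that(1)] that(2,3) by blast
        have uN: "{u, v} \<in> E" "u \<noteq> v" "u \<notin> N" if "v \<in> N" for v
          using that loop u(1) by (auto simp: N_def)
        have nbr: "e = {u, x} \<or> (\<exists>v\<in>N. e = {u, v})" if e: "e \<in> E" "u \<in> e" for e
        proof -
          obtain p where "e = {u, p}" using card2 e by (metis card_2_iff doubleton_eq_iff insertE singletonD)
          then show ?thesis using u(2)[of p] e(1) by (cases "3 \<le> vertex_degree E p") (auto simp: N_def)
        qed
        have "\<not> (\<exists>v\<^sub>1. N \<subseteq> {v\<^sub>1})"
        proof
          assume "\<exists>v\<^sub>1. N \<subseteq> {v\<^sub>1}"
          then obtain v\<^sub>1 where "N \<subseteq> {v\<^sub>1}" by blast
          then have "{e \<in> E. u \<in> e} \<subseteq> {{u, x}, {u, v\<^sub>1}}" using nbr by blast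
          then have "vertex_degree E u \<le> card {{u, x}, {u, v\<^sub>1}}"
            unfolding vertex_degree_def by (intro card_mono) auto
          also have "\<dots> \<le> 2" by (simp add: card_insert_if)
          finally show False using u(1) by simp
        qed
        then obtain v\<^sub>1 v\<^sub>2 where v12: "v\<^sub>1 \<in> N" "v\<^sub>2 \<in> N" "v\<^sub>1 \<noteq> v\<^sub>2" by blast
        let ?E0 = "E - (\<lambda>v. {u, v}) ` N"
        have E0: "e \<in> ?E0 \<Longrightarrow> v \<in> N \<Longrightarrow> v \<in> e \<Longrightarrow> e = {v, w v}" for e v
          using at by blast
        have f0: "{v, w v} \<in> ?E0" if "v \<in> N" for v
          using wE[OF that] uN that by (auto simp: doubleton_eq_iff)
        have f_ne: "{v\<^sub>1, w v\<^sub>1} \<noteq> {v\<^sub>2, w v\<^sub>2}"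
          using v12 wE(4)[OF v12(2)] by (auto simp: doubleton_eq_iff)
        \<comment> \<open>The two edges get different colours if they meet anyway. Otherwise moving
          the second one to start at \<open>v\<^sub>1\<close> makes them meet, and its colour is
          carried back afterwards.\<close>
        have "\<exists>l. proper_edge_colouring ?E0 k l \<and> l {v\<^sub>1, w v\<^sub>1} \<noteq> l {v\<^sub>2, w v\<^sub>2}"
        proof (cases "w v\<^sub>1 = w v\<^sub>2")
          case True
          have "?E0 \<subset> E" using uN(1)[OF v12(1)] v12(1) by blast
          from sub[OF this] obtain l where l: "proper_edge_colouring ?E0 k l" by blast
          moreover have "{v\<^sub>1, w v\<^sub>1} \<inter> {v\<^sub>2, w v\<^sub>2} \<noteq> {}" using True by auto
          ultimately show ?thesis
            using f0[OF v12(1)] f0[OF v12(2)] f_ne unfolding proper_edge_colouring_def by metis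
        next
          case False
          let ?E1 = "?E0 - {{v\<^sub>2, w v\<^sub>2}}"
          let ?n = "{v\<^sub>1, w v\<^sub>2}"
          let ?E2 = "insert ?n ?E1"
          have v1w2: "v\<^sub>1 \<noteq> w v\<^sub>2" "v\<^sub>2 \<noteq> w v\<^sub>1" using wE(4) v12 by auto
          have nE: "?n \<notin> E" using at[OF v12(1), of ?n] False v1w2 wE(2)[OF v12(2)]
            by (auto simp: doubleton_eq_iff)
          have u1: "e = {u, x}" if "e \<in> ?E0" "u \<in> e" for e using nbr that by blast
          have es2: "edge_separable ?E2"
          proof (rule edge_separable_merge[OF es uN(1)[OF v12(1)] uN(1)[OF v12(2)] wE(1)[OF v12(1)] wE(1)[OF v12(2)]])
            show "?E1 \<subseteq> E - {{u, v\<^sub>1}, {u, v\<^sub>2}, {v\<^sub>2, w v\<^sub>2}}" using v12 by blast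
            show "e = {v\<^sub>1, w v\<^sub>1}" if "e \<in> ?E1" "v\<^sub>1 \<in> e" for e using E0[OF _ v12(1)] that by blast
            show "v\<^sub>2 \<notin> e" if "e \<in> ?E1" for e using E0[OF _ v12(2)] that by blast
            show "e = f" if "e \<in> ?E1" "f \<in> ?E1" "u \<in> e" "u \<in> f" for e f
              using u1[of e] u1[of f] that by simp
          qed (use v12 False uN[OF v12(1)] wE[OF v12(1)] wE[OF v12(2)] v1w2 in auto)
          \<comment> \<open>At least two edges disappear and one is added, so the induction
            hypothesis applies to \<open>?E2\<close>.\<close>
          have E2E: "?E1 \<subseteq> E - {{u, v\<^sub>1}, {v\<^sub>2, w v\<^sub>2}}" using v12 by blast
          have two: "card {{u, v\<^sub>1}, {v\<^sub>2, w v\<^sub>2}} = 2"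
            using v12 uN wE by (auto simp: doubleton_eq_iff card_insert_if)
          have "card ?E1 \<le> card (E - {{u, v\<^sub>1}, {v\<^sub>2, w v\<^sub>2}})" using E2E fin by (intro card_mono) auto
          also have "\<dots> = card E - 2"
            using uN(1)[OF v12(1)] wE(1)[OF v12(2)] two by (subst card_Diff_subset) auto
          finally have "card ?E1 \<le> card E - 2" .
          moreover have "2 \<le> card E"
            using two card_mono[OF fin, of "{{u, v\<^sub>1}, {v\<^sub>2, w v\<^sub>2}}"] uN(1)[OF v12(1)] wE(1)[OF v12(2)] by auto
          moreover have "card ?E2 \<le> Suc (card ?E1)" using fin by (simp add: card_insert_if)
          ultimately have less2: "card ?E2 < card E" by linarith
          have deg2: "vertex_degree ?E2 z \<le> k" for z
          proof (cases "z = v\<^sub>1")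
            case True
            have "{e \<in> ?E2. z \<in> e} \<subseteq> {?n, {v\<^sub>1, w v\<^sub>1}}" using E0[OF _ v12(1)] True by blast
            then have "vertex_degree ?E2 z \<le> card {?n, {v\<^sub>1, w v\<^sub>1}}"
              unfolding vertex_degree_def by (intro card_mono) auto
            also have "\<dots> \<le> 2" by (simp add: card_insert_if)
            finally show ?thesis using \<open>3 \<le> k\<close> by simp
          next
            case z1: False
            show ?thesis
            proof (cases "z = w v\<^sub>2")
              case True
              have "{e \<in> ?E2. z \<in> e} \<subseteq> insert ?n ({e \<in> E. z \<in> e} - {{v\<^sub>2, w v\<^sub>2}})" by blast
              then have "vertex_degree ?E2 z \<le> card (insert ?n ({e \<in> E. z \<in> e} - {{v\<^sub>2, w v\<^sub>2}}))"
                unfolding vertex_degree_def using fin by (intro card_mono) auto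
              also have "\<dots> \<le> Suc (card ({e \<in> E. z \<in> e} - {{v\<^sub>2, w v\<^sub>2}}))"
                using fin by (simp add: card_insert_if)
              also have "\<dots> = vertex_degree E z"
                unfolding vertex_degree_def using True wE(1)[OF v12(2)] fin by (intro card_Suc_Diff1) auto
              finally show ?thesis using deg le_trans by blast
            next
              case False
              have "{e \<in> ?E2. z \<in> e} = {e \<in> ?E1. z \<in> e}" using z1 False by auto
              then have "vertex_degree ?E2 z = vertex_degree ?E1 z" by (simp add: vertex_degree_def)
              also have "\<dots> \<le> vertex_degree E z" by (rule deg_mono) blast
              finally show ?thesis using deg le_trans by blast
            qed
          qed
          have "\<exists>l. proper_edge_colouring ?E2 k l"
            by (rule less.hyps[OF less2 _ _ es2]) (use fin card2 v1w2 deg2 in auto)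
          then obtain l where l: "proper_edge_colouring ?E2 k l" by blast
          let ?l = "l({v\<^sub>2, w v\<^sub>2} := l ?n)"
          have "l ?n \<noteq> l e" if e: "e \<in> ?E1" "e \<inter> {v\<^sub>2, w v\<^sub>2} \<noteq> {}" for e
          proof -
            have "v\<^sub>2 \<notin> e" using E0[OF _ v12(2)] e(1) by blast
            then have "?n \<inter> e \<noteq> {}" using e(2) by blast
            moreover have "?n \<noteq> e" using nE e(1) by blast
            ultimately show ?thesis using e(1) by (intro proper_edge_colouringD[OF l]) auto
          qed
          with l have "proper_edge_colouring ?E0 k ?l" by (rule proper_edge_colouring_recolour)
          moreover have "l {v\<^sub>1, w v\<^sub>1} \<noteq> l ?n"
          proof -
            have "{v\<^sub>1, w v\<^sub>1} \<in> ?E1" using f0[OF v12(1)] f_ne by simp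
            moreover have "{v\<^sub>1, w v\<^sub>1} \<inter> ?n \<noteq> {}" by simp
            moreover have "{v\<^sub>1, w v\<^sub>1} \<noteq> ?n" using False by (auto simp: doubleton_eq_iff)
            ultimately show ?thesis by (intro proper_edge_colouringD[OF l]) auto
          qed
          ultimately show ?thesis using f_ne by (intro exI[of _ ?l]) simp
        qed
        then obtain l where l: "proper_edge_colouring ?E0 k l" "l {v\<^sub>1, w v\<^sub>1} \<noteq> l {v\<^sub>2, w v\<^sub>2}" by blast
        show ?thesis
          by (rule proper_edge_colouring_add_star[OF fin card2 deg[rule_format] uN(1,2) at l(1) v12 l(2)])
      qed
    qed
  qed
qed

section \<open>Strong edge colouring\<close>

lemma vertex_degree_le_max_degree:
  assumes "simple_graph V E"
  shows "vertex_degree E v \<le> max_degree V E"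
proof (cases "v \<in> V")
  case True
  have "finite V" using assms by (simp add: simple_graph_def)
  then show ?thesis unfolding max_degree_def using True by (intro Max_ge) auto
next
  case False
  then have "{e \<in> E. v \<in> e} = {}" using assms by (auto simp: simple_graph_def)
  then show ?thesis by (simp only: vertex_degree_def card.empty le0)
qed

lemma strong_chromatic_index_bounded:
  assumes "strong_edge_colouring E c" "\<forall>e\<in>E. c e < k"
  shows "strong_chromatic_index E \<le> k"
proof -
  have "card (c ` E) \<le> card {..<k}" using assms(2) by (intro card_mono) auto
  then show ?thesis using strong_chromatic_index_le[OF assms(1)] by simp
qed

lemma strong_edge_colouringI:
  assumes "\<And>e f. e \<in> E \<Longrightarrow> f \<in> E \<Longrightarrow> e \<noteq> f \<Longrightarrow> c e = c f \<Longrightarrow> e \<inter> f = {}"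
    and "\<And>e f u v. e \<in> E \<Longrightarrow> f \<in> E \<Longrightarrow> e \<noteq> f \<Longrightarrow> c e = c f \<Longrightarrow> u \<in> e \<Longrightarrow> v \<in> f \<Longrightarrow> {u, v} \<notin> E"
  shows "strong_edge_colouring E c"
  unfolding strong_edge_colouring_def induced_matching_def
proof (intro allI conjI ballI impI)
  fix i e f assume "e \<in> {e \<in> E. c e = i}" "f \<in> {e \<in> E. c e = i}" "e \<noteq> f"
  then have ef: "e \<in> E" "f \<in> E" "e \<noteq> f" "c e = c f" by auto
  then show "e \<inter> f = {}" by (rule assms(1))
  show "{u, v} \<notin> E" if "u \<in> e" "v \<in> f" for u v using ef that by (rule assms(2))
qed auto

text \<open>The pair of matching and contraction colour is encoded as one number below
  \<open>3 * k\<close>. Both ends of an edge share their colour in the contraction of its own class,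
  so the end picked by \<open>SOME\<close> is immaterial.\<close>

lemma strong_edge_colouring_of_contractions:
  assumes card2: "\<forall>e\<in>E. card e = 2" and l: "proper_edge_colouring E k l"
    and c: "\<And>i. contracted_colouring E {e \<in> E. l e = i} (c i)"
  shows "\<exists>c. strong_edge_colouring E c \<and> (\<forall>e\<in>E. c e < 3 * k)"
proof -
  let ?c = "\<lambda>e. 3 * l e + c (l e) (SOME v. v \<in> e)"
  have lt: "c i v < 3" for i v using c by (auto simp: contracted_colouring_def)
  have on_edge: "c (l e) v = c (l e) (SOME v. v \<in> e)" if "e \<in> E" "v \<in> e" for e v
  proof -
    have some: "(SOME v. v \<in> e) \<in> e" using that(2) by (rule someI)
    show ?thesis
    proof (cases "v = (SOME v. v \<in> e)")
      case False
      then have "card {v, SOME v. v \<in> e} = card e" using card2 that(1) by simp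
      moreover have "finite e" using card2 that(1) by (intro card_ge_0_finite) simp
      ultimately have "{v, SOME v. v \<in> e} = e" using some that(2) by (intro card_subset_eq) auto
      then show ?thesis
        using c[of "l e"] that(1) False unfolding contracted_colouring_def by (metis (mono_tags, lifting) mem_Collect_eq)
    qed simp
  qed
  have "strong_edge_colouring E ?c"
  proof (rule strong_edge_colouringI)
    fix e f assume ef: "e \<in> E" "f \<in> E" "e \<noteq> f" "?c e = ?c f"
    have lef: "l e = l f" using ef(4) lt[of "l e"] lt[of "l f"]
      by (metis (no_types, lifting) add.commute div_less div_mult_self2 add_0 zero_neq_numeral)
    then have ceq: "c (l e) (SOME v. v \<in> e) = c (l e) (SOME v. v \<in> f)" using ef(4) by simp
    show disj: "e \<inter> f = {}" using l ef lef unfolding proper_edge_colouring_def by blast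
    fix u v assume uv: "u \<in> e" "v \<in> f"
    show "{u, v} \<notin> E"
    proof
      assume E: "{u, v} \<in> E"
      have "u \<noteq> v" using disj uv by auto
      moreover have "c (l e) u = c (l e) v" using on_edge[OF ef(1) uv(1)] on_edge[OF ef(2) uv(2)] ceq lef by simp
      \<comment> \<open>Equal colours on adjacent vertices mean that their edge is itself
        contracted, so it would lie in the same matching as \<open>e\<close> while meeting
        \<open>e\<close>.\<close>
      ultimately have "l {u, v} = l e" using c[of "l e"] E unfolding contracted_colouring_def by blast
      moreover have "{u, v} \<noteq> e" "{u, v} \<inter> e \<noteq> {}" using disj uv by auto
      ultimately show False using proper_edge_colouringD[OF l E ef(1)] by simp
    qed
  qed
  moreover have "?c e < 3 * k" if "e \<in> E" for e
  proof -
    have "l e < k" using l that by (simp add: proper_edge_colouring_def)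
    then show ?thesis using lt[of "l e" "SOME v. v \<in> e"] by linarith
  qed
  ultimately show ?thesis by blast
qed

section \<open>Maximum degree at most 2\<close>

lemma greedy_colouring:
  assumes fin: "finite E" and sym: "\<And>e f. R e f \<Longrightarrow> R f e"
    and few: "\<And>e. e \<in> E \<Longrightarrow> card {f \<in> E. R e f} < k"
  shows "\<exists>c. (\<forall>e\<in>E. c e < k) \<and> (\<forall>e\<in>E. \<forall>f\<in>E. e \<noteq> f \<longrightarrow> R e f \<longrightarrow> c e \<noteq> (c f :: nat))"
  using fin few
proof (induction E rule: finite_induct)
  case empty
  then show ?case by simp
next
  case (insert e E)
  have le: "card {f \<in> E. R g f} \<le> card {f \<in> insert e E. R g f}" for g
    using insert.hyps(1) by (intro card_mono) auto
  have "card {f \<in> E. R g f} < k" if "g \<in> E" for g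
    using insert.prems[of g] le[of g] that by simp
  then obtain c where c: "\<forall>e\<in>E. c e < k" "\<forall>e\<in>E. \<forall>f\<in>E. e \<noteq> f \<longrightarrow> R e f \<longrightarrow> c e \<noteq> c f"
    using insert.IH by blast
  let ?N = "{f \<in> E. R e f}"
  have "card (c ` ?N) \<le> card ?N" using insert.hyps(1) by (intro card_image_le) auto
  also have "\<dots> < card {..<k}" using insert.prems[of e] le[of e] by simp
  finally have "\<not> {..<k} \<subseteq> c ` ?N"
    using card_mono[of "c ` ?N" "{..<k}"] insert.hyps(1) by fastforce
  then obtain t where t: "t < k" "t \<notin> c ` ?N" by blast
  have "c f \<noteq> t" if "f \<in> E" "R e f" for f using t(2) that by blast
  then show ?case
    using c t(1) sym insert.hyps(2) by (intro exI[of _ "c(e := t)"]) auto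
qed

text \<open>Every edge in conflict with \<open>e\<close> contains the far end of an edge adjacent to
  \<open>e\<close>. There are at most \<open>2 * (k - 1)\<close> adjacent edges and at most
  \<open>k\<close> edges at each far end, fewer than \<open>3 * k\<close> in all if \<open>k\<close>
  is 1 or 2.\<close>

lemma strong_chromatic_index_small_degree:
  assumes fin: "finite E" and card2: "\<forall>e\<in>E. card e = 2" and deg: "\<And>v. vertex_degree E v \<le> k" and k: "k \<le> 2"
  shows "strong_chromatic_index E \<le> 3 * k"
proof -
  define R where "R e f \<longleftrightarrow> e \<noteq> f \<and> (e \<inter> f \<noteq> {} \<or> (\<exists>u\<in>e. \<exists>v\<in>f. {u, v} \<in> E))" for e f :: "'a set"
  have "card {f \<in> E. R e f} < 3 * k" if e: "e \<in> E" for e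
  proof -
    obtain u x where ux: "e = {u, x}" "u \<noteq> x" using card2 e by (metis card_2_iff)
    let ?A = "\<lambda>v. {f \<in> E. v \<in> f} - {e}"
    \<comment> \<open>For an edge \<open>f\<close> adjacent to \<open>e\<close>, \<open>?B f\<close>
      contains \<open>f\<close> itself, so the union covers both the edges adjacent to
      \<open>e\<close> and those one edge further away.\<close>
    let ?B = "\<lambda>f. \<Union>p\<in>f - e. {g \<in> E. p \<in> g}"
    have other: "\<exists>p. f - e = {p}" if f: "f \<in> E" "f \<noteq> e" "f \<inter> e \<noteq> {}" for f
    proof -
      obtain a b where "f = {a, b}" "a \<noteq> b" using card2 f(1) by (metis card_2_iff)
      then show ?thesis using f(2,3) ux by auto
    qed
    have cover: "{f \<in> E. R e f} \<subseteq> (\<Union>f\<in>?A u \<union> ?A x. ?B f)"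
    proof
      fix f assume "f \<in> {f \<in> E. R e f}"
      then have f: "f \<in> E" "e \<noteq> f" "e \<inter> f \<noteq> {} \<or> (\<exists>u\<in>e. \<exists>v\<in>f. {u, v} \<in> E)" by (auto simp: R_def)
      show "f \<in> (\<Union>f\<in>?A u \<union> ?A x. ?B f)"
      proof (cases "e \<inter> f = {}")
        case False
        then obtain p where p: "f - e = {p}" using other[of f] f by (auto simp: Int_commute)
        then have "f \<in> ?B f" using f(1) by blast
        moreover have "f \<in> ?A u \<union> ?A x" using False f(1,2) ux by auto
        ultimately show ?thesis by blast
      next
        case True
        then obtain a b where ab: "a \<in> e" "b \<in> f" "{a, b} \<in> E" using f(3) by blast
        have "b \<notin> e" using True ab(2) by blast
        then have "f \<in> ?B {a, b}" using ab(2) f(1) by blast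
        moreover have "{a, b} \<in> ?A u \<union> ?A x" using ab \<open>b \<notin> e\<close> ux by auto
        ultimately show ?thesis by blast
      qed
    qed
    have A: "card (?A v) \<le> k - 1" if "v \<in> e" for v
    proof -
      have "card (?A v) = vertex_degree E v - 1"
        unfolding vertex_degree_def using e that fin by (subst card_Diff_singleton) auto
      then show ?thesis using deg[of v] by simp
    qed
    have B: "card (?B f) \<le> k" if f: "f \<in> ?A u \<union> ?A x" for f
    proof -
      obtain p where "f - e = {p}" using other[of f] f ux by auto
      then show ?thesis using deg[of p] by (simp add: vertex_degree_def)
    qed
    have "card {f \<in> E. R e f} \<le> card (\<Union>f\<in>?A u \<union> ?A x. ?B f)"
      using fin card2 by (intro card_mono[OF _ cover]) (auto intro: finite_subset[of _ E])
    also have "\<dots> \<le> (\<Sum>f\<in>?A u \<union> ?A x. card (?B f))" using fin by (intro card_UN_le) auto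
    also have "\<dots> \<le> (\<Sum>f\<in>?A u \<union> ?A x. k)" using B by (intro sum_mono)
    also have "\<dots> = card (?A u \<union> ?A x) * k" by simp
    also have "\<dots> \<le> (2 * (k - 1)) * k"
      using A[of u] A[of x] card_Un_le[of "?A u" "?A x"] ux by (intro mult_le_mono1) auto
    also have "\<dots> < 3 * k"
    proof -
      have "0 < vertex_degree E u" unfolding vertex_degree_def using fin e ux by (auto simp: card_gt_0_iff)
      then have "k = 1 \<or> k = 2" using deg[of u] k by linarith
      then show ?thesis by auto
    qed
    finally show ?thesis .
  qed
  moreover have "R f e" if "R e f" for e f
    using that unfolding R_def by (metis Int_commute insert_commute)
  ultimately obtain c where c: "\<forall>e\<in>E. c e < 3 * k" "\<forall>e\<in>E. \<forall>f\<in>E. e \<noteq> f \<longrightarrow> R e f \<longrightarrow> c e \<noteq> c f"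
    using greedy_colouring[OF fin, of R "3 * k"] by blast
  have "strong_edge_colouring E c"
  proof (rule strong_edge_colouringI)
    fix e f assume "e \<in> E" "f \<in> E" "e \<noteq> f" "c e = c f"
    with c(2) have R: "\<not> R e f" "e \<noteq> f" by auto
    then show "e \<inter> f = {}" by (simp add: R_def)
    show "{u, v} \<notin> E" if "u \<in> e" "v \<in> f" for u v using R that unfolding R_def by blast
  qed
  then show ?thesis using c(1) by (rule strong_chromatic_index_bounded)
qed

theorem theorem1:
  fixes V :: "'a set" and E :: "'a set set"
  assumes "simple_graph V E"
    and "chordless E"
  shows "strong_chromatic_index E \<le> 3 * max_degree V E"
proof -
  have fin: "finite E" using assms(1) by (rule simple_graph_finite_edges)
  have card2: "\<forall>e\<in>E. card e = 2" using assms(1) by (simp add: simple_graph_def)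
  have es: "edge_separable E" using assms(2) card2 by (rule chordless_edge_separable)
  note deg = vertex_degree_le_max_degree[OF assms(1)]
  show ?thesis
  proof (cases "max_degree V E \<le> 2")
    case True
    show ?thesis by (rule strong_chromatic_index_small_degree[OF fin card2 deg True])
  next
    case False
    then obtain l where l: "proper_edge_colouring E (max_degree V E) l"
      using proper_edge_colouring_exists[OF fin card2 es, of "max_degree V E"] deg by auto
    have "matching {e \<in> E. l e = i}" for i
      using l unfolding matching_def proper_edge_colouring_def by auto
    then have "\<exists>c. contracted_colouring E {e \<in> E. l e = i} c" for i
      by (intro matching_contraction_3_colourable[OF fin card2 es]) auto
    then obtain c where "\<And>i. contracted_colouring E {e \<in> E. l e = i} (c i)" by metis
    from strong_edge_colouring_of_contractions[OF card2 l this]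
    show ?thesis using strong_chromatic_index_bounded by blast
  qed
qed

end
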